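(* Let $a>0$ and let $T\in\mathcal{C}_a$ be a convex body in $\mathbb{R}^n$ with $|T|=1$. Then $$\sigma^2(T)\le\frac{2}{a(n+2)L_T^2}.$$ In particular, for every constant $c>0$ there is a constant $C>0$ depending only on $c$ (not on $n$, $a$ or $T$) such that, if $a>c/n$, then $\sigma^2(T)\le C$.
   Context: A convex body in $\mathbb{R}^n$ is a compact convex set with non-empty interior; it is symmetric if $K=-K$. $|\cdot|$ is Lebesgue measure, $B_2^n$ the Euclidean unit ball. Support function: $h_K(x)=\max_{y\in K}x\cdot y$; polar body: $K^{\circ}=\{x: x\cdot y\le 1\ \forall y\in K\}$. For convex bodies $K, L$ containing the origin in their interiors and $a>0$, $K+_2 a\cdot L$ is the convex body with support function $(h_K^2+a h_L^2)^{1/2}$. A symmetric convex body $K$ is isotropic if $\int_K(x\cdot y)^2dx$ is constant as a function of $y\in S^{n-1}$; then its isotropic constant $L_K>0$ is given by $$L_K^2=\frac{1}{|K|^{\frac{n+2}{n}}}\int_K(x\cdot y)^2dx\quad(y\in S^{n-1}).$$ For $a>0$, $$\mathcal{C}_a=\big\{(K^{\circ}+_2a\cdot B_2^n)^{\circ} : K\text{ is a symmetric convex body},\ (K^{\circ}+_2a\cdot B_2^n)^{\circ}\text{ is isotropic}\big\}.$$ For a symmetric isotropic convex body $K$ in $\mathbb{R}^n$, $$\sigma^2(K)=\frac{|K|\int_K\|x\|_2^4dx-\big[\int_K\|x\|_2^2dx\big]^2}{\frac1n\big[\int_K\|x\|_2^2dx\big]^2}.$$ *)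

theory Defs
  imports "HOL-Analysis.Analysis"
begin

text \<open>
  The constant in the second half of the theorem must not depend on the dimension, so the
  dimension \<open>n\<close> has to be a quantified natural number and not an index type. We take the library's
  \<^const>\<open>Euclidean_space\<close> as a model of n-dimensional space: its points are the functions
  \<open>x :: nat \<Rightarrow> real\<close> with \<open>x i = 0\<close> for \<open>i \<ge> n\<close>. This function type has no vector space or
  inner product instance, so the linear structure is written out coordinatewise.
\<close>

abbreviation Rn :: "nat \<Rightarrow> (nat \<Rightarrow> real) set" where
  "Rn n \<equiv> topspace (Euclidean_space n)"

definition dot :: "nat \<Rightarrow> (nat \<Rightarrow> real) \<Rightarrow> (nat \<Rightarrow> real) \<Rightarrow> real" where
  "dot n x y = (\<Sum>i<n. x i * y i)"

abbreviation norm2 :: "nat \<Rightarrow> (nat \<Rightarrow> real) \<Rightarrow> real" where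
  "norm2 n x \<equiv> L2_set x {..<n}"

definition unit_ball :: "nat \<Rightarrow> (nat \<Rightarrow> real) set" where
  "unit_ball n = {x \<in> Rn n. norm2 n x \<le> 1}"

definition unit_sphere :: "nat \<Rightarrow> (nat \<Rightarrow> real) set" where
  "unit_sphere n = {x \<in> Rn n. norm2 n x = 1}"

text \<open>
  Lebesgue measure on \<^term>\<open>Rn n\<close>: the n-fold product of the Lebesgue-Borel measure lives on functions
  that are \<^const>\<open>undefined\<close> outside \<open>{..<n}\<close>; it is transported along the map replacing
  those values by 0.
\<close>

definition pad :: "nat \<Rightarrow> (nat \<Rightarrow> real) \<Rightarrow> nat \<Rightarrow> real" where
  "pad n x = (\<lambda>i. if i < n then x i else 0)"

definition lebesgue_Rn :: "nat \<Rightarrow> (nat \<Rightarrow> real) measure" where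
  "lebesgue_Rn n = distr (\<Pi>\<^sub>M i\<in>{..<n}. lborel) borel (pad n)"

lemma measurable_pad [measurable]: "pad n \<in> (\<Pi>\<^sub>M i\<in>{..<n}. lborel) \<rightarrow>\<^sub>M borel"
  unfolding pad_def
proof (rule measurable_coordinatewise_then_product)
  fix i
  show "(\<lambda>x. if i < n then x i else 0) \<in> borel_measurable (\<Pi>\<^sub>M i\<in>{..<n}. (lborel :: real measure))"
    by (cases "i < n") simp_all
qed

definition vol :: "nat \<Rightarrow> (nat \<Rightarrow> real) set \<Rightarrow> real" where
  "vol n K = measure (lebesgue_Rn n) K"

definition integral_over :: "nat \<Rightarrow> (nat \<Rightarrow> real) set \<Rightarrow> ((nat \<Rightarrow> real) \<Rightarrow> real) \<Rightarrow> real" where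
  "integral_over n K f = set_lebesgue_integral (lebesgue_Rn n) K f"

definition convex_Rn :: "(nat \<Rightarrow> real) set \<Rightarrow> bool" where
  "convex_Rn K \<longleftrightarrow> (\<forall>x\<in>K. \<forall>y\<in>K. \<forall>u\<ge>0. \<forall>v\<ge>0. u + v = 1 \<longrightarrow> (\<lambda>i. u * x i + v * y i) \<in> K)"

definition convex_body :: "nat \<Rightarrow> (nat \<Rightarrow> real) set \<Rightarrow> bool" where
  "convex_body n K \<longleftrightarrow>
     compactin (Euclidean_space n) K \<and> convex_Rn K \<and> (Euclidean_space n) interior_of K \<noteq> {}"

definition symmetric_convex_body :: "nat \<Rightarrow> (nat \<Rightarrow> real) set \<Rightarrow> bool" where
  "symmetric_convex_body n K \<longleftrightarrow> convex_body n K \<and> K = (\<lambda>x i. - x i) ` K"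

text \<open>For a convex body the supremum is attained, hence equal to the maximum.\<close>

definition support_fun :: "nat \<Rightarrow> (nat \<Rightarrow> real) set \<Rightarrow> (nat \<Rightarrow> real) \<Rightarrow> real" where
  "support_fun n K x = (SUP y\<in>K. dot n x y)"

definition polar :: "nat \<Rightarrow> (nat \<Rightarrow> real) set \<Rightarrow> (nat \<Rightarrow> real) set" where
  "polar n K = {x \<in> Rn n. \<forall>y\<in>K. dot n x y \<le> 1}"

text \<open>
  \<open>is_sum2 n K a L M\<close> says that \<open>M\<close> is the body \<open>K +\<^sub>2 a \<cdot> L\<close>, i.e. the convex body with the prescribed
  support function. It is used for \<open>K\<close>, \<open>L\<close> with the origin in their interiors and \<open>a > 0\<close>; then
  exactly one such \<open>M\<close> exists.
\<close>

definition is_sum2 ::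
  "nat \<Rightarrow> (nat \<Rightarrow> real) set \<Rightarrow> real \<Rightarrow> (nat \<Rightarrow> real) set \<Rightarrow> (nat \<Rightarrow> real) set \<Rightarrow> bool" where
  "is_sum2 n K a L M \<longleftrightarrow> convex_body n M \<and>
     (\<forall>x\<in>Rn n. support_fun n M x = sqrt ((support_fun n K x)\<^sup>2 + a * (support_fun n L x)\<^sup>2))"

definition isotropic :: "nat \<Rightarrow> (nat \<Rightarrow> real) set \<Rightarrow> bool" where
  "isotropic n K \<longleftrightarrow> symmetric_convex_body n K \<and>
     (\<exists>c. \<forall>y\<in>unit_sphere n. integral_over n K (\<lambda>x. (dot n x y)\<^sup>2) = c)"

definition isotropic_constant :: "nat \<Rightarrow> (nat \<Rightarrow> real) set \<Rightarrow> real" where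
  "isotropic_constant n K = (THE L. L > 0 \<and>
     (\<forall>y\<in>unit_sphere n.
        L\<^sup>2 = 1 / (vol n K powr (real (n + 2) / real n)) * integral_over n K (\<lambda>x. (dot n x y)\<^sup>2)))"

definition class_C :: "nat \<Rightarrow> real \<Rightarrow> (nat \<Rightarrow> real) set set" where
  "class_C n a = {polar n M | K M. symmetric_convex_body n K \<and>
     is_sum2 n (polar n K) a (unit_ball n) M \<and> isotropic n (polar n M)}"

definition sigma_sq :: "nat \<Rightarrow> (nat \<Rightarrow> real) set \<Rightarrow> real" where
  "sigma_sq n K =
     (vol n K * integral_over n K (\<lambda>x. norm2 n x ^ 4) - (integral_over n K (\<lambda>x. (norm2 n x)\<^sup>2))\<^sup>2)
     / (1 / real n * (integral_over n K (\<lambda>x. (norm2 n x)\<^sup>2))\<^sup>2)"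

end

theory Submission
  imports Defs "HOL-Probability.Distributions"
begin

text \<open>
  Write \<open>T = {Q \<le> 1}\<close> with \<open>Q x = \<psi> x + a \<bar>x\<bar>\<^sup>2\<close>, where \<open>\<psi>\<close> is the square of the support function of the
  polar of \<open>K\<close>. Since \<open>Q\<close> is 2-homogeneous, the moments of \<open>\<bar>x\<bar>\<^sup>2\<close> on \<open>T\<close> are those of the density
  \<open>exp (- Q)\<close> up to Gamma factors, and the claim reduces to \<open>Var \<bar>x\<bar>\<^sup>2 \<le> E \<bar>x\<bar>\<^sup>2 / a\<close> for that density.
  For two independent copies \<open>x = p + q\<close> and \<open>y = p - q\<close> one has \<open>\<bar>x\<bar>\<^sup>2 - \<bar>y\<bar>\<^sup>2 = 4 p \<cdot> q\<close>. Given \<open>p\<close>, the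
  density of \<open>q\<close> is \<open>exp (- 2 a \<bar>q\<bar>\<^sup>2)\<close> times an even log-concave function, so by the
  Prekopa-Leindler inequality the second moment of \<open>p \<cdot> q\<close> is at most that of the Gaussian, \<open>\<bar>p\<bar>\<^sup>2 / (4 a)\<close>.
  For the second part it remains to bound \<open>L\<close> from below, which only uses \<open>\<bar>T\<bar> = 1\<close>.
\<close>

section \<open>The Prekopa-Leindler inequality\<close>

text \<open>The uniform measure on T does not split when two copies are rotated, but exp (- Q) does:
  by the parallelogram law a (|x|^2 + |y|^2) becomes 2 a (|p|^2 + |q|^2), and \<psi> (p + q) +
  \<psi> (p - q) is an even convex function of q for each fixed p. This is why a density replaces
  the body. For fixed p the fluctuation of a quadratic function has become the second moment of a
  linear functional of q, where comparison with a Gaussian is possible. Constants: E|p|^2 = E|x|^2 /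
  2, because \<psi> is even and so |x + y|^2 and |x - y|^2 have the same mean. Hence twice the
  variance is at most 16 E|p|^2 / (4 a) = 2 E|x|^2 / a. With h = (n + 2) / 2 the Gamma factors at
  orders 0, 2, 4 are in ratio 1 : h : h (h + 1); passing back to T therefore divides the bound by h,
  which gives 2 / (a (n + 2)). Finally E|x|^2 = n L^2 on T, and sigma^2 is n times the variance
  divided by (n L^2)^2.\<close>

lemma cofinal_sequence_real:
  fixes A :: "real set"
  assumes "A \<noteq> {}"
  obtains r :: "nat \<Rightarrow> real" where "incseq r" "\<And>k. \<exists>a\<in>A. r k \<le> a" "\<And>x. x \<in> A \<Longrightarrow> \<exists>k. x \<le> r k"
proof (cases "bdd_above A")
  case False
  show ?thesis
  proof (rule that)
    show "incseq (\<lambda>k. real k)" by (simp add: incseq_def)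
    show "\<exists>a\<in>A. real k \<le> a" for k
      using False by (meson bdd_above.I linear)
    show "\<exists>k. x \<le> real k" for x by (rule real_arch_simple)
  qed
next
  case bdd: True
  show ?thesis
  proof (cases "Sup A \<in> A")
    case True
    then show ?thesis
      using that[of "\<lambda>_. Sup A"] bdd by (auto simp: incseq_def intro: cSup_upper)
  next
    case False
    show ?thesis
    proof (rule that)
      show "incseq (\<lambda>k. Sup A - 1 / real (Suc k))"
        by (auto simp: incseq_def frac_le)
      show "\<exists>a\<in>A. Sup A - 1 / real (Suc k) \<le> a" for k
        using less_cSupD[of A "Sup A - 1 / real (Suc k)"] assms bdd
        by (smt (verit) divide_pos_pos less_eq_real_def of_nat_0_less_iff zero_less_Suc)
      show "\<exists>k. x \<le> Sup A - 1 / real (Suc k)" if "x \<in> A" for x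
      proof -
        have "x < Sup A"
          using False that bdd cSup_upper[of x A] by (metis less_eq_real_def)
        then obtain k where "inverse (real (Suc k)) < Sup A - x"
          using reals_Archimedean[of "Sup A - x"] by auto
        then show ?thesis by (intro exI[of _ k]) (simp add: inverse_eq_divide)
      qed
    qed
  qed
qed

section \<open>Brunn-Minkowski on the real line\<close>

lemma emeasure_lborel_double:
  fixes A :: "real set"
  assumes [measurable]: "A \<in> sets borel"
  shows "emeasure lborel A = 2 * emeasure lborel {z. 2 * z + t \<in> A}"
proof -
  have "emeasure lborel A = (\<integral>\<^sup>+x. indicator A x \<partial>lborel)" by simp
  also have "\<dots> = ennreal \<bar>2\<bar> * (\<integral>\<^sup>+x. indicator A (t + 2 * x) \<partial>lborel)"
    by (rule nn_integral_real_affine) auto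
  also have "(\<integral>\<^sup>+x. indicator A (t + 2 * x) \<partial>lborel) = (\<integral>\<^sup>+x. indicator {z. 2 * z + t \<in> A} x \<partial>lborel)"
    by (intro nn_integral_cong) (auto simp: indicator_def add.commute)
  also have "\<dots> = emeasure lborel {z. 2 * z + t \<in> A}"
    by (intro nn_integral_indicator) measurable
  finally show ?thesis by simp
qed

text \<open>Averaging the part of \<open>A\<close> below \<open>a\<close> with \<open>b\<close>, and
  the part of \<open>B\<close> above \<open>b\<close> with \<open>a\<close>, gives two subsets of
  \<open>C\<close> on opposite sides of (a + b) / 2. They share at most one point, so their
  measures, each half that of the cut set, add up.\<close>

lemma brunn_minkowski_real_aux:
  fixes A B C :: "real set"
  assumes [measurable]: "A \<in> sets borel" "B \<in> sets borel" "C \<in> sets borel"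
    and mid: "\<And>x y. x \<in> A \<Longrightarrow> y \<in> B \<Longrightarrow> (x + y) / 2 \<in> C"
    and a: "a \<in> A" and b: "b \<in> B"
  shows "emeasure lborel (A \<inter> {..a}) + emeasure lborel (B \<inter> {b..}) \<le> 2 * emeasure lborel C"
proof -
  define X where "X = {z. 2 * z + - b \<in> A \<inter> {..a}}"
  define Y where "Y = {z. 2 * z + - a \<in> B \<inter> {b..}}"
  have [measurable]: "X \<in> sets borel" "Y \<in> sets borel" unfolding X_def Y_def by measurable
  have "X \<inter> Y \<subseteq> {(a + b) / 2}" by (auto simp: X_def Y_def)
  then have null: "emeasure lborel (X \<inter> Y) = 0"
    by (metis emeasure_lborel_singleton emeasure_mono emeasure_empty le_zero_eq sets.empty_sets
        sets_lborel singletonI borel_singleton)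
  have "X \<union> Y \<subseteq> C"
  proof
    fix z assume "z \<in> X \<union> Y"
    then show "z \<in> C"
      using mid[of "2 * z + - b" b] mid[of a "2 * z + - a"] a b by (auto simp: X_def Y_def)
  qed
  then have "emeasure lborel (X \<union> Y) \<le> emeasure lborel C" by (intro emeasure_mono) auto
  moreover have "emeasure lborel X + emeasure lborel Y = emeasure lborel (X \<union> Y)"
    using emeasure_Un_Int[of X lborel Y] null by simp
  moreover have "emeasure lborel (A \<inter> {..a}) = 2 * emeasure lborel X"
    unfolding X_def by (rule emeasure_lborel_double) measurable
  moreover have "emeasure lborel (B \<inter> {b..}) = 2 * emeasure lborel Y"
    unfolding Y_def by (rule emeasure_lborel_double) measurable
  ultimately show ?thesis by (metis distrib_left mult_left_mono zero_le)
qed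

text \<open>\<open>A\<close> need not have a largest element nor \<open>B\<close> a smallest one, so
  the cuts run along cofinal sequences and the measures pass to the limit. A cut \<open>r k\<close>
  need not lie in \<open>A\<close>: some point of \<open>A\<close> lies above it, and raising the
  cut only enlarges the left-hand side.\<close>

lemma brunn_minkowski_real:
  fixes A B C :: "real set"
  assumes [measurable]: "A \<in> sets borel" "B \<in> sets borel" "C \<in> sets borel"
    and ne: "A \<noteq> {}" "B \<noteq> {}"
    and mid: "\<And>x y. x \<in> A \<Longrightarrow> y \<in> B \<Longrightarrow> (x + y) / 2 \<in> C"
  shows "emeasure lborel A + emeasure lborel B \<le> 2 * emeasure lborel C"
proof -
  obtain r where r: "incseq r" "\<And>k. \<exists>a\<in>A. r k \<le> a" "\<And>x. x \<in> A \<Longrightarrow> \<exists>k. x \<le> r k"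
    using cofinal_sequence_real[OF ne(1)] by metis
  \<comment> \<open>Reflection turns approaching the lower end of \<open>B\<close> into approaching
    the upper end of -B.\<close>
  have "uminus ` B \<noteq> {}" using ne by auto
  then obtain s where s: "incseq s" "\<And>k. \<exists>a\<in>uminus ` B. s k \<le> a"
    "\<And>x. x \<in> uminus ` B \<Longrightarrow> \<exists>k. x \<le> s k"
    using cofinal_sequence_real by metis
  have "(\<lambda>k. emeasure lborel (A \<inter> {..r k})) \<longlonglongrightarrow> emeasure lborel (\<Union>k. A \<inter> {..r k})"
    using r(1) by (intro Lim_emeasure_incseq) (auto simp: incseq_def intro: order_trans)
  also have "(\<Union>k. A \<inter> {..r k}) = A" using r(3) by auto
  finally have limA: "(\<lambda>k. emeasure lborel (A \<inter> {..r k})) \<longlonglongrightarrow> emeasure lborel A" .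
  have "(\<lambda>k. emeasure lborel (B \<inter> {- s k..})) \<longlonglongrightarrow> emeasure lborel (\<Union>k. B \<inter> {- s k..})"
    using s(1) by (intro Lim_emeasure_incseq) (auto simp: incseq_def intro: order_trans[OF le_imp_neg_le])
  also have "(\<Union>k. B \<inter> {- s k..}) = B"
  proof -
    have "\<exists>k. - s k \<le> x" if "x \<in> B" for x
      using s(3)[of "- x"] that by (auto simp: minus_le_iff)
    then show ?thesis by auto
  qed
  finally have limB: "(\<lambda>k. emeasure lborel (B \<inter> {- s k..})) \<longlonglongrightarrow> emeasure lborel B" .
  show ?thesis
  proof (rule LIMSEQ_le_const2[OF tendsto_add[OF limA limB]], intro exI allI impI)
    fix k :: nat
    obtain a where a: "a \<in> A" "r k \<le> a" using r(2) by auto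
    obtain b where b: "b \<in> B" "s k \<le> - b" using s(2) by blast
    have "emeasure lborel (A \<inter> {..r k}) + emeasure lborel (B \<inter> {- s k..})
        \<le> emeasure lborel (A \<inter> {..a}) + emeasure lborel (B \<inter> {b..})"
      using a b by (intro add_mono emeasure_mono) auto
    also have "\<dots> \<le> 2 * emeasure lborel C"
      by (rule brunn_minkowski_real_aux) (use a b mid in auto)
    finally show "emeasure lborel (A \<inter> {..r k}) + emeasure lborel (B \<inter> {- s k..})
        \<le> 2 * emeasure lborel C" .
  qed
qed

section \<open>Prekopa-Leindler on the real line\<close>

lemma ennreal_four_mult_le_sum_square: "4 * (x * y) \<le> (x + y)\<^sup>2" for x y :: ennreal
proof (cases x; cases y)
  fix r s assume *: "x = ennreal r" "0 \<le> r" "y = ennreal s" "0 \<le> s"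
  have "4 * (r * s) \<le> (r + s)\<^sup>2"
    using sum_squares_bound[of r s] by (simp add: power2_eq_square algebra_simps)
  then have "ennreal (4 * (r * s)) \<le> ennreal ((r + s)\<^sup>2)" by (rule ennreal_leI)
  then show ?thesis
    using * by (simp add: ennreal_mult ennreal_plus flip: ennreal_numeral ennreal_power)
qed (auto simp: ennreal_top_eq_mult_iff power2_eq_square)

lemma ennreal_mult_strict_mono:
  fixes x y u v :: ennreal
  assumes "x < y" "u < v"
  shows "x * u < y * v"
proof -
  obtain r s where *: "x = ennreal r" "0 \<le> r" "u = ennreal s" "0 \<le> s"
    using assms by (metis ennreal_cases less_top_ennreal neq_top_trans top.not_eq_extremum less_imp_le not_less_iff_gr_or_eq)
  have "y \<noteq> 0" "v \<noteq> 0" using assms by auto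
  show ?thesis
  proof (cases y; cases v)
    fix p q assume "y = ennreal p" "0 \<le> p" "v = ennreal q" "0 \<le> q"
    then show ?thesis
      using * assms by (auto simp: ennreal_less_iff mult_strict_mono' simp flip: ennreal_mult)
  qed (use * \<open>y \<noteq> 0\<close> \<open>v \<noteq> 0\<close> in \<open>auto simp: ennreal_top_mult ennreal_mult_top simp flip: ennreal_mult\<close>)
qed

lemma ennreal_power2_le_imp_le: "x\<^sup>2 \<le> y\<^sup>2 \<Longrightarrow> x \<le> y" for x y :: ennreal
  by (metis ennreal_mult_strict_mono leD leI power2_eq_square)

text \<open>The levels \<open>t\<close> are real although \<open>f\<close> may be infinite; at such
  points the inner integral is the infinite length of the positive half-line. Strict superlevel sets
  suit the later use: f x > t and g y > t give f x * g y > t^2.\<close>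

lemma nn_integral_layer_cake:
  fixes f :: "'a \<Rightarrow> ennreal"
  assumes "sigma_finite_measure M" and [measurable]: "f \<in> borel_measurable M"
  shows "(\<integral>\<^sup>+x. f x \<partial>M) = (\<integral>\<^sup>+t. indicator {0<..} t * emeasure M {x \<in> space M. ennreal t < f x} \<partial>lborel)"
proof -
  interpret M: sigma_finite_measure M by fact
  interpret pair_sigma_finite M "lborel :: real measure" ..
  have eq: "f x = (\<integral>\<^sup>+t. indicator {0<..} t * indicator {t. ennreal t < f x} t \<partial>lborel)" for x
  proof (cases "f x")
    case (real r)
    have "(\<lambda>t. indicator {0<..} t * indicator {t. ennreal t < f x} t) = (indicator {0<..<r} :: real \<Rightarrow> ennreal)"
      using real by (auto simp: indicator_def fun_eq_iff ennreal_less_iff)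
    then show ?thesis using real by simp
  next
    case top
    have "(\<lambda>t. indicator {0<..} t * indicator {t. ennreal t < f x} t) = (indicator {0<..} :: real \<Rightarrow> ennreal)"
      using top by (auto simp: indicator_def fun_eq_iff)
    moreover have "emeasure lborel {0::real<..} = top"
    proof -
      have "of_nat n \<le> emeasure lborel {0::real<..}" for n
        using emeasure_mono[of "{0<..real n}" "{0<..}" lborel] by (force simp: ennreal_of_nat_eq_real_of_nat)
      then have "(SUP n. (of_nat n :: ennreal)) \<le> emeasure lborel {0::real<..}" by (intro SUP_least)
      then show ?thesis by (simp add: ennreal_SUP_of_nat_eq_top top_unique)
    qed
    ultimately show ?thesis using top by simp
  qed
  have "(\<integral>\<^sup>+x. f x \<partial>M) = (\<integral>\<^sup>+x. (\<integral>\<^sup>+t. indicator {0<..} t * indicator {t. ennreal t < f x} t \<partial>lborel) \<partial>M)"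
    using eq by simp
  also have "\<dots> = (\<integral>\<^sup>+t. (\<integral>\<^sup>+x. indicator {0<..} t * indicator {t. ennreal t < f x} t \<partial>M) \<partial>lborel)"
    by (rule Fubini'[symmetric]) measurable
  also have "\<dots> = (\<integral>\<^sup>+t. indicator {0<..} t * emeasure M {x \<in> space M. ennreal t < f x} \<partial>lborel)"
  proof (rule nn_integral_cong)
    fix t :: real
    have "(\<integral>\<^sup>+x. indicator {0<..} t * indicator {t. ennreal t < f x} t \<partial>M)
        = (\<integral>\<^sup>+x. indicator {0<..} t * indicator {x \<in> space M. ennreal t < f x} x \<partial>M)"
      by (intro nn_integral_cong) (auto simp: indicator_def)
    also have "\<dots> = indicator {0<..} t * emeasure M {x \<in> space M. ennreal t < f x}"
      by (simp add: nn_integral_cmult)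
    finally show "(\<integral>\<^sup>+x. indicator {0<..} t * indicator {t. ennreal t < f x} t \<partial>M) = \<dots>" .
  qed
  finally show ?thesis .
qed

text \<open>Brunn-Minkowski is applied level by level, and it needs both superlevel sets to be
  nonempty. The common supremum 1 guarantees this for 0 < t < 1 and makes both sets empty for larger
  t; with different suprema one set could be empty while the other is not.\<close>

lemma prekopa_leindler_real_normalized:
  fixes f g h :: "real \<Rightarrow> ennreal"
  assumes [measurable]: "f \<in> borel_measurable borel" "g \<in> borel_measurable borel" "h \<in> borel_measurable borel"
    and f: "(SUP x. f x) = 1" and g: "(SUP x. g x) = 1"
    and le: "\<And>x y. f x * g y \<le> (h ((x + y) / 2))\<^sup>2"
  shows "(\<integral>\<^sup>+x. f x \<partial>lborel) + (\<integral>\<^sup>+x. g x \<partial>lborel) \<le> 2 * (\<integral>\<^sup>+x. h x \<partial>lborel)"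
proof -
  have sf: "sigma_finite_measure (lborel :: real measure)" ..
  let ?S = "\<lambda>f t. emeasure lborel {x \<in> space lborel. ennreal t < f x}"
  have [measurable]: "(\<lambda>t. ?S u t) \<in> borel_measurable borel" if [measurable]: "u \<in> borel_measurable borel" for u
    by measurable
  have level: "?S f t + ?S g t \<le> 2 * ?S h t" if t: "0 < t" for t
  proof (cases "t < 1")
    case True
    have ne: "{x. ennreal t < u x} \<noteq> {}" if "(SUP x. u x) = 1" for u :: "real \<Rightarrow> ennreal"
    proof -
      have "ennreal t < (SUP x. u x)" using True t that by (simp add: ennreal_less_iff flip: ennreal_1)
      then show ?thesis by (auto simp: less_SUP_iff)
    qed
    have "emeasure lborel {x. ennreal t < f x} + emeasure lborel {x. ennreal t < g x}
       \<le> 2 * emeasure lborel {x. ennreal t < h x}"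
    proof (rule brunn_minkowski_real)
      fix x y assume "x \<in> {x. ennreal t < f x}" "y \<in> {x. ennreal t < g x}"
      then have "ennreal t * ennreal t < f x * g y" by (intro ennreal_mult_strict_mono) auto
      also have "\<dots> \<le> (h ((x + y) / 2))\<^sup>2" by (rule le)
      finally show "(x + y) / 2 \<in> {x. ennreal t < h x}"
        by (metis (mono_tags, lifting) leD leI mem_Collect_eq power2_eq_square power_mono zero_le)
    qed (use ne[OF f] ne[OF g] in auto)
    then show ?thesis by simp
  next
    case False
    have "f x \<le> 1" "g x \<le> 1" for x
      using f g SUP_upper[of x UNIV f] SUP_upper[of x UNIV g] by auto
    moreover have "1 \<le> ennreal t" using False by (simp flip: ennreal_1 add: ennreal_leI)
    ultimately have "{x \<in> space lborel. ennreal t < f x} = {}" "{x \<in> space lborel. ennreal t < g x} = {}"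
      using order_trans[of _ 1 "ennreal t"] by (auto simp: not_less simp del: ennreal_ge_1)
    then show ?thesis by simp
  qed
  have "(\<integral>\<^sup>+x. f x \<partial>lborel) + (\<integral>\<^sup>+x. g x \<partial>lborel)
     = (\<integral>\<^sup>+t. indicator {0<..} t * ?S f t + indicator {0<..} t * ?S g t \<partial>lborel)"
    by (simp add: nn_integral_layer_cake[OF sf, of f] nn_integral_layer_cake[OF sf, of g] nn_integral_add)
  also have "\<dots> \<le> (\<integral>\<^sup>+t. 2 * (indicator {0<..} t * ?S h t) \<partial>lborel)"
  proof (rule nn_integral_mono)
    fix t :: real
    show "indicator {0<..} t * ?S f t + indicator {0<..} t * ?S g t \<le> 2 * (indicator {0<..} t * ?S h t)"
      using level[of t] by (cases "0 < t") auto
  qed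
  also have "\<dots> = 2 * (\<integral>\<^sup>+x. h x \<partial>lborel)"
    by (simp add: nn_integral_layer_cake[OF sf, of h] nn_integral_cmult)
  finally show ?thesis .
qed

text \<open>Boundedness makes the suprema finite, so \<open>f\<close> and \<open>g\<close> can be
  normalised to supremum 1; the hypothesis is kept by scaling \<open>h\<close> with the geometric
  mean of the two factors. The inequality of arithmetic and geometric means then turns the additive
  bound into a product, and the scaling cancels.\<close>

lemma prekopa_leindler_real_bounded:
  fixes f g h :: "real \<Rightarrow> ennreal"
  assumes [measurable]: "f \<in> borel_measurable borel" "g \<in> borel_measurable borel" "h \<in> borel_measurable borel"
    and bdd: "\<And>x. f x \<le> ennreal c" "\<And>x. g x \<le> ennreal c"
    and le: "\<And>x y. f x * g y \<le> (h ((x + y) / 2))\<^sup>2"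
  shows "(\<integral>\<^sup>+x. f x \<partial>lborel) * (\<integral>\<^sup>+x. g x \<partial>lborel) \<le> (\<integral>\<^sup>+x. h x \<partial>lborel)\<^sup>2"
proof (cases "(SUP x. f x) = 0 \<or> (SUP x. g x) = 0")
  case True
  then have "(\<forall>x. f x = 0) \<or> (\<forall>x. g x = 0)" by (metis SUP_upper UNIV_I le_zero_eq)
  then show ?thesis by auto
next
  case False
  have ex: "\<exists>\<alpha>>0. (SUP x. u x) = ennreal \<alpha>" if "\<And>x. u x \<le> ennreal c" "(SUP x. u x) \<noteq> 0"
    for u :: "real \<Rightarrow> ennreal"
  proof -
    have "(SUP x. u x) \<le> ennreal c" using that by (intro SUP_least)
    then obtain r where "(SUP x. u x) = ennreal r" "0 \<le> r"
      by (metis ennreal_cases ennreal_neq_top neq_top_trans)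
    then show ?thesis using that(2) by (intro exI[of _ r]) (auto simp: less_le)
  qed
  obtain \<alpha> where \<alpha>: "\<alpha> > 0" "(SUP x. f x) = ennreal \<alpha>" using ex[of f, OF bdd(1)] False by auto
  obtain \<beta> where \<beta>: "\<beta> > 0" "(SUP x. g x) = ennreal \<beta>" using ex[of g, OF bdd(2)] False by auto
  let ?a = "ennreal (1 / \<alpha>)" and ?b = "ennreal (1 / \<beta>)" and ?c = "ennreal (1 / sqrt (\<alpha> * \<beta>))"
  have c2: "?c\<^sup>2 = ?a * ?b" using \<alpha> \<beta> by (simp add: ennreal_power power_divide flip: ennreal_mult)
  have "(\<integral>\<^sup>+x. ?a * f x \<partial>lborel) + (\<integral>\<^sup>+x. ?b * g x \<partial>lborel) \<le> 2 * (\<integral>\<^sup>+x. ?c * h x \<partial>lborel)"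
  proof (rule prekopa_leindler_real_normalized)
    show "(SUP x. ?a * f x) = 1" "(SUP x. ?b * g x) = 1"
      using \<alpha> \<beta> by (simp_all add: SUP_mult_left_ennreal[symmetric] flip: ennreal_mult)
    fix x y
    have "?a * f x * (?b * g y) = ?c\<^sup>2 * (f x * g y)" unfolding c2 by (simp add: ac_simps)
    also have "\<dots> \<le> ?c\<^sup>2 * (h ((x + y) / 2))\<^sup>2" by (intro mult_left_mono le) auto
    finally show "?a * f x * (?b * g y) \<le> (?c * h ((x + y) / 2))\<^sup>2" by (simp add: power_mult_distrib)
  qed auto
  then have *: "?a * (\<integral>\<^sup>+x. f x \<partial>lborel) + ?b * (\<integral>\<^sup>+x. g x \<partial>lborel) \<le> 2 * (?c * (\<integral>\<^sup>+x. h x \<partial>lborel))"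
    by (simp add: nn_integral_cmult)
  have "4 * (?c\<^sup>2 * ((\<integral>\<^sup>+x. f x \<partial>lborel) * (\<integral>\<^sup>+x. g x \<partial>lborel)))
      = 4 * (?a * (\<integral>\<^sup>+x. f x \<partial>lborel) * (?b * (\<integral>\<^sup>+x. g x \<partial>lborel)))"
    unfolding c2 by (simp add: ac_simps)
  also have "\<dots> \<le> (?a * (\<integral>\<^sup>+x. f x \<partial>lborel) + ?b * (\<integral>\<^sup>+x. g x \<partial>lborel))\<^sup>2"
    by (rule ennreal_four_mult_le_sum_square)
  also have "\<dots> \<le> (2 * (?c * (\<integral>\<^sup>+x. h x \<partial>lborel)))\<^sup>2" using * by (intro power_mono) auto
  also have "\<dots> = 4 * (?c\<^sup>2 * (\<integral>\<^sup>+x. h x \<partial>lborel)\<^sup>2)" by (simp add: power_mult_distrib)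
  finally show ?thesis
    using \<alpha> \<beta> by (simp add: ennreal_mult_le_mult_iff ennreal_power)
qed

text \<open>Truncating \<open>f\<close> and \<open>g\<close> at height k only lowers their product,
  so the hypothesis persists with the same \<open>h\<close>, and monotone convergence removes the
  truncation.\<close>

lemma prekopa_leindler_real:
  fixes f g h :: "real \<Rightarrow> ennreal"
  assumes [measurable]: "f \<in> borel_measurable borel" "g \<in> borel_measurable borel" "h \<in> borel_measurable borel"
    and le: "\<And>x y. f x * g y \<le> (h ((x + y) / 2))\<^sup>2"
  shows "(\<integral>\<^sup>+x. f x \<partial>lborel) * (\<integral>\<^sup>+x. g x \<partial>lborel) \<le> (\<integral>\<^sup>+x. h x \<partial>lborel)\<^sup>2"
proof -
  have lim: "(\<lambda>k. \<integral>\<^sup>+x. min (u x) (ennreal (real k)) \<partial>lborel) \<longlonglongrightarrow> (\<integral>\<^sup>+x. u x \<partial>lborel)"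
    if [measurable]: "u \<in> borel_measurable borel" for u :: "real \<Rightarrow> ennreal"
  proof (rule nn_integral_LIMSEQ)
    show "incseq (\<lambda>k x. min (u x) (ennreal (real k)))"
      unfolding incseq_def le_fun_def by (intro allI impI min.mono order_refl ennreal_leI) simp
    fix x
    have "(\<lambda>k. min (u x) (of_nat k)) \<longlonglongrightarrow> min (u x) top"
      by (intro tendsto_min tendsto_const of_nat_tendsto_top_ennreal)
    then show "(\<lambda>k. min (u x) (ennreal (real k))) \<longlonglongrightarrow> u x" by (simp add: ennreal_of_nat_eq_real_of_nat)
  qed auto
  have "(\<integral>\<^sup>+x. min (f x) (ennreal (real k)) \<partial>lborel) * (\<integral>\<^sup>+x. min (g x) (ennreal (real k)) \<partial>lborel)
      \<le> (\<integral>\<^sup>+x. h x \<partial>lborel)\<^sup>2" for k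
  proof (rule prekopa_leindler_real_bounded[where c = "real k"])
    fix x y
    have "min (f x) (ennreal (real k)) * min (g y) (ennreal (real k)) \<le> f x * g y" by (intro mult_mono) auto
    then show "min (f x) (ennreal (real k)) * min (g y) (ennreal (real k)) \<le> (h ((x + y) / 2))\<^sup>2"
      using le order_trans by blast
  qed auto
  moreover have inc: "mono (\<lambda>k. \<integral>\<^sup>+x. min (u x) (ennreal (real k)) \<partial>lborel)" for u :: "real \<Rightarrow> ennreal"
    unfolding mono_def by (intro allI impI nn_integral_mono min.mono order_refl ennreal_leI) simp
  \<comment> \<open>The suprema are taken separately in the two factors, which calls for independent
    truncation heights; monotonicity reduces them to their maximum.\<close>
  ultimately have bound: "(\<integral>\<^sup>+x. min (f x) (ennreal (real j)) \<partial>lborel) * (\<integral>\<^sup>+x. min (g x) (ennreal (real k)) \<partial>lborel)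
      \<le> (\<integral>\<^sup>+x. h x \<partial>lborel)\<^sup>2" for j k
    by (meson inc max.cobounded1 max.cobounded2 monoD mult_mono order_trans zero_le)
  have sup: "(SUP k. \<integral>\<^sup>+x. min (u x) (ennreal (real k)) \<partial>lborel) = (\<integral>\<^sup>+x. u x \<partial>lborel)"
    if "u \<in> borel_measurable borel" for u :: "real \<Rightarrow> ennreal"
    using LIMSEQ_unique[OF lim[OF that] LIMSEQ_SUP[OF inc]] by simp
  show ?thesis
    by (simp flip: sup[of f] sup[of g] add: SUP_mult_left_ennreal SUP_mult_right_ennreal bound SUP_le_iff)
qed

section \<open>Finite products: Prekopa-Leindler and affine substitutions\<close>

abbreviation lborelPi :: "'i set \<Rightarrow> ('i \<Rightarrow> real) measure" where
  "lborelPi I \<equiv> Pi\<^sub>M I (\<lambda>_. lborel)"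

interpretation lborelPi: product_sigma_finite "\<lambda>_::'i. lborel :: real measure" ..

text \<open>Integrating out one coordinate preserves the hypothesis, because on each line it is
  exactly the one-dimensional inequality. Over no coordinates the space is a single point and the
  hypothesis is the claim. Midpoints are restricted to \<open>I\<close> to stay in the extensional
  product space.\<close>

lemma prekopa_leindler_lborelPi:
  fixes f g h :: "('i \<Rightarrow> real) \<Rightarrow> ennreal"
  assumes "finite I"
    and "f \<in> borel_measurable (lborelPi I)" "g \<in> borel_measurable (lborelPi I)"
      "h \<in> borel_measurable (lborelPi I)"
    and "\<And>x y. x \<in> space (lborelPi I) \<Longrightarrow> y \<in> space (lborelPi I) \<Longrightarrow>
      f x * g y \<le> (h (\<lambda>i\<in>I. (x i + y i) / 2))\<^sup>2"
  shows "(\<integral>\<^sup>+x. f x \<partial>lborelPi I) * (\<integral>\<^sup>+x. g x \<partial>lborelPi I) \<le> (\<integral>\<^sup>+x. h x \<partial>lborelPi I)\<^sup>2"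
  using assms
proof (induction I arbitrary: f g h rule: finite_induct)
  case empty
  show ?case
    using empty(4)[of "\<lambda>_. undefined" "\<lambda>_. undefined"]
    by (simp add: PiM_empty nn_integral_count_space_finite power2_eq_square restrict_def)
next
  case (insert i I)
  note [measurable] = insert.prems(1-3)
  let ?m = "\<lambda>u x. \<integral>\<^sup>+t. u (x(i := t)) \<partial>lborel"
  have upd: "x(i := t) \<in> space (lborelPi (insert i I))" if "x \<in> space (lborelPi I)" for x t
    using that by (auto simp: space_PiM PiE_def extensional_def)
  have "(\<integral>\<^sup>+x. ?m f x \<partial>lborelPi I) * (\<integral>\<^sup>+x. ?m g x \<partial>lborelPi I) \<le> (\<integral>\<^sup>+x. ?m h x \<partial>lborelPi I)\<^sup>2"
  proof (rule insert.IH)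
    fix x y assume x: "x \<in> space (lborelPi I)" and y: "y \<in> space (lborelPi I)"
    define z where "z = (\<lambda>j\<in>I. (x j + y j) / 2)"
    have z: "z \<in> space (lborelPi I)" by (auto simp: z_def space_PiM)
    note [measurable] = x y z
    show "?m f x * ?m g y \<le> (?m h z)\<^sup>2"
    proof (rule prekopa_leindler_real)
      fix s t
      have "(\<lambda>j\<in>insert i I. ((x(i := s)) j + (y(i := t)) j) / 2) = z(i := (s + t) / 2)"
        using insert.hyps by (auto simp: z_def fun_eq_iff restrict_def)
      then show "f (x(i := s)) * g (y(i := t)) \<le> (h (z(i := (s + t) / 2)))\<^sup>2"
        using insert.prems(4)[OF upd[OF x] upd[OF y], of s t] by (simp only:)
    qed measurable
  qed measurable
  then show ?case by (simp add: lborelPi.product_nn_integral_insert insert.hyps)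
qed

text \<open>One statement covers reflections (c = -1), translations (c = 1), the factor 2 in the
  sum-difference substitution and the dilations by sqrt t used for sublevel sets.\<close>

lemma nn_integral_lborelPi_affine:
  fixes f :: "('i \<Rightarrow> real) \<Rightarrow> ennreal"
  assumes "finite I" "f \<in> borel_measurable (lborelPi I)" and c: "c \<noteq> 0"
  shows "(\<integral>\<^sup>+x. f x \<partial>lborelPi I) =
    ennreal (\<bar>c\<bar> ^ card I) * (\<integral>\<^sup>+x. f (\<lambda>i\<in>I. t i + c * x i) \<partial>lborelPi I)"
  using assms(1,2)
proof (induction I arbitrary: f rule: finite_induct)
  case empty
  show ?case by (simp add: PiM_empty nn_integral_count_space_finite restrict_def)
next
  case (insert i I)
  note [measurable] = insert.prems
  have [measurable]: "(\<lambda>x. \<lambda>j\<in>J. t j + c * x j) \<in> lborelPi J \<rightarrow>\<^sub>M lborelPi J" for J :: "'i set"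
    by measurable
  have "(\<integral>\<^sup>+x. f x \<partial>lborelPi (insert i I)) = (\<integral>\<^sup>+x. \<integral>\<^sup>+s. f (x(i := s)) \<partial>lborel \<partial>lborelPi I)"
    by (simp add: lborelPi.product_nn_integral_insert insert.hyps)
  also have "\<dots> = ennreal (\<bar>c\<bar> ^ card I) *
      (\<integral>\<^sup>+x. \<integral>\<^sup>+s. f ((\<lambda>j\<in>I. t j + c * x j)(i := s)) \<partial>lborel \<partial>lborelPi I)"
    by (rule insert.IH) measurable
  also have "(\<integral>\<^sup>+x. \<integral>\<^sup>+s. f ((\<lambda>j\<in>I. t j + c * x j)(i := s)) \<partial>lborel \<partial>lborelPi I) =
      (\<integral>\<^sup>+x. ennreal \<bar>c\<bar> * (\<integral>\<^sup>+s. f (\<lambda>j\<in>insert i I. t j + c * (x(i := s)) j) \<partial>lborel) \<partial>lborelPi I)"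
  proof (rule nn_integral_cong)
    fix x assume x: "x \<in> space (lborelPi I)"
    define z where "z = (\<lambda>j\<in>I. t j + c * x j)"
    have z: "z \<in> space (lborelPi I)" by (auto simp: z_def space_PiM)
    note [measurable] = x z
    have "(\<integral>\<^sup>+s. f (z(i := s)) \<partial>lborel) = ennreal \<bar>c\<bar> * (\<integral>\<^sup>+s. f (z(i := t i + c * s)) \<partial>lborel)"
      by (rule nn_integral_real_affine[OF _ c]) measurable
    moreover have "z(i := t i + c * s) = (\<lambda>j\<in>insert i I. t j + c * (x(i := s)) j)" for s
      using insert.hyps by (auto simp: z_def fun_eq_iff restrict_def)
    ultimately show "(\<integral>\<^sup>+s. f ((\<lambda>j\<in>I. t j + c * x j)(i := s)) \<partial>lborel) =
        ennreal \<bar>c\<bar> * (\<integral>\<^sup>+s. f (\<lambda>j\<in>insert i I. t j + c * (x(i := s)) j) \<partial>lborel)"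
      by (simp only: z_def[symmetric])
  qed
  also have "\<dots> = ennreal \<bar>c\<bar> * (\<integral>\<^sup>+x. \<integral>\<^sup>+s. f (\<lambda>j\<in>insert i I. t j + c * (x(i := s)) j) \<partial>lborel \<partial>lborelPi I)"
    by (rule nn_integral_cmult) measurable
  also have "(\<integral>\<^sup>+x. \<integral>\<^sup>+s. f (\<lambda>j\<in>insert i I. t j + c * (x(i := s)) j) \<partial>lborel \<partial>lborelPi I) =
      (\<integral>\<^sup>+x. f (\<lambda>j\<in>insert i I. t j + c * x j) \<partial>lborelPi (insert i I))"
    by (rule lborelPi.product_nn_integral_insert[symmetric]) (use insert.hyps in measurable)
  finally show ?case
    using insert.hyps by (simp add: ennreal_mult ac_simps del: restrict_apply)
qed

section \<open>Even log-concave perturbations of a Gaussian\<close>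

text \<open>The left integrand is a density centred at \<open>s p\<close>; Prekopa-Leindler is applied to it and its
  reflection, whose midpoint function is the density centred at the origin.\<close>

lemma even_log_concave_gaussian_exp_moment:
  fixes I :: "'i set" and R :: "('i \<Rightarrow> real) \<Rightarrow> real" and p :: "'i \<Rightarrow> real" and a s :: real
  defines "W \<equiv> \<lambda>q. exp (- a * (\<Sum>i\<in>I. (q i)\<^sup>2)) * R q"
  assumes I: "finite I" and [measurable]: "R \<in> borel_measurable (lborelPi I)"
    and a: "a > 0" and pos: "\<And>x. 0 \<le> R x"
    and even: "\<And>x. x \<in> space (lborelPi I) \<Longrightarrow> R (\<lambda>i\<in>I. - x i) = R x"
    and lc: "\<And>x y. x \<in> space (lborelPi I) \<Longrightarrow> y \<in> space (lborelPi I) \<Longrightarrow>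
      R x * R y \<le> (R (\<lambda>i\<in>I. (x i + y i) / 2))\<^sup>2"
  shows "(\<integral>\<^sup>+q. ennreal (exp (2 * a * s * (\<Sum>i\<in>I. p i * q i) - a * s\<^sup>2 * (\<Sum>i\<in>I. (p i)\<^sup>2)) * W q) \<partial>lborelPi I)
    \<le> (\<integral>\<^sup>+q. ennreal (W q) \<partial>lborelPi I)"
proof -
  have [measurable]: "W \<in> borel_measurable (lborelPi I)" unfolding W_def by measurable
  have Wpos: "0 \<le> W q" for q by (simp add: W_def pos)
  define f where "f = (\<lambda>s q. ennreal (exp (2 * a * s * (\<Sum>i\<in>I. p i * q i) - a * s\<^sup>2 * (\<Sum>i\<in>I. (p i)\<^sup>2)) * W q))"
  have [measurable]: "f s \<in> borel_measurable (lborelPi I)" for s unfolding f_def by measurable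
  have "(\<integral>\<^sup>+q. f s q \<partial>lborelPi I) * (\<integral>\<^sup>+q. f (- s) q \<partial>lborelPi I) \<le> (\<integral>\<^sup>+q. ennreal (W q) \<partial>lborelPi I)\<^sup>2"
  proof (rule prekopa_leindler_lborelPi[OF I])
    fix x y assume x: "x \<in> space (lborelPi I)" and y: "y \<in> space (lborelPi I)"
    define z where "z = (\<lambda>i\<in>I. (x i + y i) / 2)"
    \<comment> \<open>After completing the squares the Gaussian exponents are - a |x - s p|^2 and -
      a |y + s p|^2. The shifts cancel in x + y = 2 z, so convexity of the squared norm compares
      their sum with 2 |z|^2.\<close>
    have "2 * (\<Sum>i\<in>I. (z i)\<^sup>2) = (\<Sum>i\<in>I. 2 * (z i)\<^sup>2)" by (simp add: sum_distrib_left)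
    also have "\<dots> \<le> (\<Sum>i\<in>I. (x i - s * p i)\<^sup>2 + (y i + s * p i)\<^sup>2)"
    proof (rule sum_mono)
      fix i assume i: "i \<in> I"
      have "0 \<le> ((x i - s * p i) - (y i + s * p i))\<^sup>2" by simp
      then show "2 * (z i)\<^sup>2 \<le> (x i - s * p i)\<^sup>2 + (y i + s * p i)\<^sup>2"
        using i unfolding z_def by (simp add: power2_eq_square field_simps)
    qed
    also have "\<dots> = (\<Sum>i\<in>I. (x i)\<^sup>2) + (\<Sum>i\<in>I. (y i)\<^sup>2) - 2 * s * (\<Sum>i\<in>I. p i * x i)
        + 2 * s * (\<Sum>i\<in>I. p i * y i) + 2 * s\<^sup>2 * (\<Sum>i\<in>I. (p i)\<^sup>2)"
      unfolding sum_distrib_left sum.distrib[symmetric] sum_subtractf[symmetric]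
      by (intro sum.cong) (auto simp: power2_eq_square algebra_simps)
    finally have "a * (2 * (\<Sum>i\<in>I. (z i)\<^sup>2)) \<le> a * \<dots>" using a by (intro mult_left_mono) auto
    then have "exp (2 * a * s * (\<Sum>i\<in>I. p i * x i) - a * s\<^sup>2 * (\<Sum>i\<in>I. (p i)\<^sup>2)) * exp (- a * (\<Sum>i\<in>I. (x i)\<^sup>2))
        * (exp (2 * a * - s * (\<Sum>i\<in>I. p i * y i) - a * (- s)\<^sup>2 * (\<Sum>i\<in>I. (p i)\<^sup>2)) * exp (- a * (\<Sum>i\<in>I. (y i)\<^sup>2)))
        \<le> (exp (- a * (\<Sum>i\<in>I. (z i)\<^sup>2)))\<^sup>2"
      by (simp add: power2_eq_square algebra_simps flip: exp_add)
    then have "exp (2 * a * s * (\<Sum>i\<in>I. p i * x i) - a * s\<^sup>2 * (\<Sum>i\<in>I. (p i)\<^sup>2)) * exp (- a * (\<Sum>i\<in>I. (x i)\<^sup>2))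
        * (exp (2 * a * - s * (\<Sum>i\<in>I. p i * y i) - a * (- s)\<^sup>2 * (\<Sum>i\<in>I. (p i)\<^sup>2)) * exp (- a * (\<Sum>i\<in>I. (y i)\<^sup>2)))
        * (R x * R y) \<le> (exp (- a * (\<Sum>i\<in>I. (z i)\<^sup>2)))\<^sup>2 * (R z)\<^sup>2"
      using lc[OF x y] pos by (intro mult_mono) (auto simp: z_def)
    then have "ennreal (exp (2 * a * s * (\<Sum>i\<in>I. p i * x i) - a * s\<^sup>2 * (\<Sum>i\<in>I. (p i)\<^sup>2)) * W x
        * (exp (2 * a * - s * (\<Sum>i\<in>I. p i * y i) - a * (- s)\<^sup>2 * (\<Sum>i\<in>I. (p i)\<^sup>2)) * W y)) \<le> ennreal ((W z)\<^sup>2)"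
      unfolding W_def by (intro ennreal_leI) (simp add: power_mult_distrib ac_simps)
    then show "f s x * f (- s) y \<le> (ennreal (W (\<lambda>i\<in>I. (x i + y i) / 2)))\<^sup>2"
      unfolding f_def z_def[symmetric] using Wpos by (simp add: ennreal_mult flip: ennreal_power)
  qed measurable
  \<comment> \<open>Evenness of \<open>R\<close> makes both factors on the left equal, so the
    inequality becomes one between squares.\<close>
  moreover have "(\<integral>\<^sup>+q. f (- s) q \<partial>lborelPi I) = (\<integral>\<^sup>+q. f s q \<partial>lborelPi I)"
  proof -
    have "(\<integral>\<^sup>+q. f (- s) q \<partial>lborelPi I) = (\<integral>\<^sup>+q. f (- s) (\<lambda>i\<in>I. - q i) \<partial>lborelPi I)"
      using nn_integral_lborelPi_affine[OF I, of "f (- s)" "-1" "\<lambda>_. 0"] by simp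
    also have "\<dots> = (\<integral>\<^sup>+q. f s q \<partial>lborelPi I)"
      by (intro nn_integral_cong) (simp add: f_def W_def even sum_negf)
    finally show ?thesis .
  qed
  ultimately have "(\<integral>\<^sup>+q. f s q \<partial>lborelPi I)\<^sup>2 \<le> (\<integral>\<^sup>+q. ennreal (W q) \<partial>lborelPi I)\<^sup>2"
    by (simp only: power2_eq_square)
  then have "(\<integral>\<^sup>+q. f s q \<partial>lborelPi I) \<le> (\<integral>\<^sup>+q. ennreal (W q) \<partial>lborelPi I)"
    by (rule ennreal_power2_le_imp_le)
  then show ?thesis by (simp add: f_def)
qed

text \<open>Equivalent to |sinh (x / 2)| >= |x / 2|. It extracts a second moment from the
  exponential moments at s and - s, whose odd parts cancel.\<close>

lemma exp_plus_exp_minus_ge: "2 + x\<^sup>2 \<le> exp x + exp (- x)" for x :: real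
proof -
  have "\<bar>x / 2\<bar>\<^sup>2 \<le> \<bar>(exp (x / 2) - inverse (exp (x / 2))) / 2\<bar>\<^sup>2"
    by (intro power_mono real_le_abs_sinh) simp
  then have "x\<^sup>2 \<le> (exp (x / 2) - exp (- (x / 2)))\<^sup>2"
    by (simp add: exp_minus power_divide)
  also have "\<dots> = exp x + exp (- x) - 2"
    by (simp add: power2_diff flip: exp_double exp_add)
  finally show ?thesis by simp
qed

text \<open>The bound is the second-order term at \<open>s = 0\<close> of the preceding lemma.\<close>

lemma even_log_concave_gaussian_variance:
  fixes I :: "'i set" and R :: "('i \<Rightarrow> real) \<Rightarrow> real" and p :: "'i \<Rightarrow> real" and a :: real
  defines "W \<equiv> \<lambda>q. exp (- a * (\<Sum>i\<in>I. (q i)\<^sup>2)) * R q"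
  assumes I: "finite I" and [measurable]: "R \<in> borel_measurable (lborelPi I)"
    and a: "a > 0" and pos: "\<And>x. 0 \<le> R x"
    and even: "\<And>x. x \<in> space (lborelPi I) \<Longrightarrow> R (\<lambda>i\<in>I. - x i) = R x"
    and lc: "\<And>x y. x \<in> space (lborelPi I) \<Longrightarrow> y \<in> space (lborelPi I) \<Longrightarrow>
      R x * R y \<le> (R (\<lambda>i\<in>I. (x i + y i) / 2))\<^sup>2"
  shows "(\<integral>\<^sup>+q. ennreal ((\<Sum>i\<in>I. p i * q i)\<^sup>2 * W q) \<partial>lborelPi I)
    \<le> ennreal ((\<Sum>i\<in>I. (p i)\<^sup>2) / (2 * a)) * (\<integral>\<^sup>+q. ennreal (W q) \<partial>lborelPi I)"
proof -
  have [measurable]: "W \<in> borel_measurable (lborelPi I)" unfolding W_def by measurable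
  have Wpos: "0 \<le> W q" for q by (simp add: W_def pos)
  define n where "n = (\<Sum>i\<in>I. (p i)\<^sup>2)"
  define D where "D = (\<lambda>q. \<Sum>i\<in>I. p i * q i)"
  have [measurable]: "D \<in> borel_measurable (lborelPi I)" unfolding D_def by measurable
  define Z where "Z = (\<integral>\<^sup>+q. ennreal (W q) \<partial>lborelPi I)"
  define V where "V = (\<integral>\<^sup>+q. ennreal ((D q)\<^sup>2 * W q) \<partial>lborelPi I)"
  have n: "0 \<le> n" by (simp add: n_def sum_nonneg)
  \<comment> \<open>Average of the exponential-moment bounds at s and - s; with x = 2 a s D the
    quadratic term is 4 a^2 s^2 D^2, and half of it is the coefficient here.\<close>
  have main: "Z + ennreal (2 * a\<^sup>2 * s\<^sup>2) * V \<le> ennreal (exp (a * s\<^sup>2 * n)) * Z" for s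
  proof -
    have half: "(\<integral>\<^sup>+q. ennreal (exp (2 * a * s * D q) * W q) \<partial>lborelPi I) \<le> ennreal (exp (a * s\<^sup>2 * n)) * Z" for s
    proof -
      have "(\<integral>\<^sup>+q. ennreal (exp (2 * a * s * D q) * W q) \<partial>lborelPi I) =
          (\<integral>\<^sup>+q. ennreal (exp (a * s\<^sup>2 * n)) * ennreal (exp (2 * a * s * D q - a * s\<^sup>2 * n) * W q) \<partial>lborelPi I)"
        by (intro nn_integral_cong) (simp add: exp_diff Wpos flip: ennreal_mult)
      also have "\<dots> = ennreal (exp (a * s\<^sup>2 * n)) * (\<integral>\<^sup>+q. ennreal (exp (2 * a * s * D q - a * s\<^sup>2 * n) * W q) \<partial>lborelPi I)"
        by (rule nn_integral_cmult) measurable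
      also have "(\<integral>\<^sup>+q. ennreal (exp (2 * a * s * D q - a * s\<^sup>2 * n) * W q) \<partial>lborelPi I) \<le> Z"
        using even_log_concave_gaussian_exp_moment[of I R a s p] I a pos even lc
        by (simp add: D_def n_def Z_def W_def)
      finally show ?thesis by (simp add: mult_left_mono)
    qed
    have "2 * (Z + ennreal (2 * a\<^sup>2 * s\<^sup>2) * V) =
        (\<integral>\<^sup>+q. ennreal ((2 + (2 * a * s * D q)\<^sup>2) * W q) \<partial>lborelPi I)"
    proof -
      have "2 * (Z + ennreal (2 * a\<^sup>2 * s\<^sup>2) * V) = (\<integral>\<^sup>+q. 2 * (ennreal (W q) + ennreal (2 * a\<^sup>2 * s\<^sup>2) * ennreal ((D q)\<^sup>2 * W q)) \<partial>lborelPi I)"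
        by (simp add: Z_def V_def nn_integral_cmult nn_integral_add)
      also have "\<dots> = (\<integral>\<^sup>+q. ennreal ((2 + (2 * a * s * D q)\<^sup>2) * W q) \<partial>lborelPi I)"
      proof (rule nn_integral_cong)
        fix q
        have "2 * (ennreal (W q) + ennreal (2 * a\<^sup>2 * s\<^sup>2) * ennreal ((D q)\<^sup>2 * W q)) =
          ennreal (2 * (W q + (2 * a\<^sup>2 * s\<^sup>2) * ((D q)\<^sup>2 * W q)))"
          by (simp add: Wpos flip: ennreal_mult ennreal_plus ennreal_numeral)
        then show "2 * (ennreal (W q) + ennreal (2 * a\<^sup>2 * s\<^sup>2) * ennreal ((D q)\<^sup>2 * W q)) =
          ennreal ((2 + (2 * a * s * D q)\<^sup>2) * W q)"
          by (simp add: power_mult_distrib algebra_simps)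
      qed
      finally show ?thesis .
    qed
    also have "\<dots> \<le> (\<integral>\<^sup>+q. ennreal (exp (2 * a * s * D q) * W q) + ennreal (exp (2 * a * - s * D q) * W q) \<partial>lborelPi I)"
    proof (rule nn_integral_mono)
      fix q
      have "(2 + (2 * a * s * D q)\<^sup>2) * W q \<le> (exp (2 * a * s * D q) + exp (- (2 * a * s * D q))) * W q"
        by (intro mult_right_mono exp_plus_exp_minus_ge Wpos)
      then show "ennreal ((2 + (2 * a * s * D q)\<^sup>2) * W q)
          \<le> ennreal (exp (2 * a * s * D q) * W q) + ennreal (exp (2 * a * - s * D q) * W q)"
        by (simp add: Wpos distrib_right ennreal_leI flip: ennreal_plus)
    qed
    also have "\<dots> \<le> ennreal (exp (a * s\<^sup>2 * n)) * Z + ennreal (exp (a * (- s)\<^sup>2 * n)) * Z"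
      using add_mono[OF half[of s] half[of "- s"]] by (simp add: nn_integral_add)
    also have "\<dots> = 2 * (ennreal (exp (a * s\<^sup>2 * n)) * Z)" by (simp add: mult_2)
    finally show ?thesis by (subst (asm) ennreal_mult_le_mult_iff) auto
  qed
  \<comment> \<open>If \<open>Z\<close> is infinite the bound is trivial except for n = 0, where the
    right-hand side is 0 * top = 0; but then p vanishes on \<open>I\<close> and so does
    \<open>V\<close>.\<close>
  have "V \<le> ennreal (n / (2 * a)) * Z"
  proof (cases "Z = top")
    case True
    show ?thesis
    proof (cases "n = 0")
      case True
      then have "p i = 0" if "i \<in> I" for i
        using I that by (auto simp: n_def sum_nonneg_eq_0_iff)
      then show ?thesis by (simp add: V_def D_def)
    next
      case False
      then show ?thesis using n a True by (simp add: ennreal_mult_top)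
    qed
  next
    case False
    then obtain z where z: "Z = ennreal z" "0 \<le> z" by (cases Z) auto
    \<comment> \<open>The instance s = 1 already shows that \<open>V\<close> is finite, so that the
      limit can be taken in the reals.\<close>
    have "ennreal (2 * a\<^sup>2) * V \<le> Z + ennreal (2 * a\<^sup>2) * V" by simp
    also have "\<dots> \<le> ennreal (exp (a * n)) * Z" using main[of 1] by simp
    finally have "ennreal (2 * a\<^sup>2) * V \<le> ennreal (exp (a * n)) * Z" .
    then have "V \<noteq> top" using a z by (auto simp: ennreal_mult_top top_unique simp flip: ennreal_mult)
    then obtain v where v: "V = ennreal v" "0 \<le> v" by (cases V) auto
    \<comment> \<open>In the variable t = s^2 the left side of \<open>main\<close> is affine, so the
      bound is a difference quotient of exp (a n t) at 0; its limit from the right is a n.\<close>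
    have le: "2 * a\<^sup>2 * v \<le> z * ((exp (a * n * t) - exp (a * n * 0)) / (t - 0))" if t: "t > 0" for t
    proof -
      have "ennreal (z + 2 * a\<^sup>2 * t * v) \<le> ennreal (exp (a * n * t) * z)"
        using main[of "sqrt t"] t z v by (simp add: ennreal_mult ennreal_plus ac_simps)
      then have "z + 2 * a\<^sup>2 * t * v \<le> exp (a * n * t) * z" using z by (simp add: ennreal_le_iff)
      then show ?thesis using t by (simp add: field_simps)
    qed
    have "((\<lambda>t. exp (a * n * t)) has_field_derivative a * n) (at 0)"
      by (auto intro!: derivative_eq_intros)
    then have "((\<lambda>t. (exp (a * n * t) - exp (a * n * 0)) / (t - 0)) \<longlongrightarrow> a * n) (at_right 0)"
      unfolding has_field_derivative_iff by (rule filterlim_mono) (auto simp: at_le)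
    then have "((\<lambda>t. z * ((exp (a * n * t) - exp (a * n * 0)) / (t - 0))) \<longlongrightarrow> z * (a * n)) (at_right 0)"
      by (rule tendsto_mult_left)
    then have "2 * a\<^sup>2 * v \<le> z * (a * n)"
      by (rule tendsto_lowerbound) (use le in \<open>auto intro!: eventually_at_right_less[THEN eventually_mono]\<close>)
    then have "v \<le> n / (2 * a) * z" using a by (simp add: field_simps power2_eq_square)
    then show ?thesis using z v n a by (simp add: ennreal_leI flip: ennreal_mult)
  qed
  then show ?thesis by (simp add: V_def D_def n_def Z_def)
qed

section \<open>Two independent copies and the sum-difference substitution\<close>

lemma nn_integral_lborelPi_sum_diff:
  fixes F :: "('i \<Rightarrow> real) \<Rightarrow> ('i \<Rightarrow> real) \<Rightarrow> ennreal"
  assumes I: "finite I" and F[measurable]: "(\<lambda>(x, y). F x y) \<in> borel_measurable (lborelPi I \<Otimes>\<^sub>M lborelPi I)"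
  shows "(\<integral>\<^sup>+x. \<integral>\<^sup>+y. F x y \<partial>lborelPi I \<partial>lborelPi I) =
    ennreal (2 ^ card I) *
      (\<integral>\<^sup>+p. \<integral>\<^sup>+q. F (\<lambda>i\<in>I. p i + q i) (\<lambda>i\<in>I. p i - q i) \<partial>lborelPi I \<partial>lborelPi I)"
proof -
  interpret finite_product_sigma_finite "\<lambda>_::'i. lborel :: real measure" I by standard (rule I)
  interpret pair_sigma_finite "lborelPi I" "lborelPi I" ..
  \<comment> \<open>The substitution is split into two affine ones: y = 2 p - x for fixed x, which
    produces the Jacobian 2 ^ card I, then after exchanging the integrals the translation x = p + q,
    which leaves y = p - q.\<close>
  have "(\<integral>\<^sup>+x. \<integral>\<^sup>+y. F x y \<partial>lborelPi I \<partial>lborelPi I) =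
      (\<integral>\<^sup>+x. ennreal (2 ^ card I) * (\<integral>\<^sup>+p. F x (\<lambda>i\<in>I. - x i + 2 * p i) \<partial>lborelPi I) \<partial>lborelPi I)"
  proof (rule nn_integral_cong)
    fix x assume [measurable]: "x \<in> space (lborelPi I)"
    show "(\<integral>\<^sup>+y. F x y \<partial>lborelPi I) =
      ennreal (2 ^ card I) * (\<integral>\<^sup>+p. F x (\<lambda>i\<in>I. - x i + 2 * p i) \<partial>lborelPi I)"
      using nn_integral_lborelPi_affine[OF I, of "F x" 2 "\<lambda>i. - x i"] by simp
  qed
  also have "\<dots> = ennreal (2 ^ card I) * (\<integral>\<^sup>+x. \<integral>\<^sup>+p. F x (\<lambda>i\<in>I. - x i + 2 * p i) \<partial>lborelPi I \<partial>lborelPi I)"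
    by (rule nn_integral_cmult) measurable
  also have "(\<integral>\<^sup>+x. \<integral>\<^sup>+p. F x (\<lambda>i\<in>I. - x i + 2 * p i) \<partial>lborelPi I \<partial>lborelPi I) =
      (\<integral>\<^sup>+p. \<integral>\<^sup>+x. F x (\<lambda>i\<in>I. - x i + 2 * p i) \<partial>lborelPi I \<partial>lborelPi I)"
    by (rule Fubini'[symmetric]) measurable
  also have "\<dots> = (\<integral>\<^sup>+p. \<integral>\<^sup>+q. F (\<lambda>i\<in>I. p i + q i) (\<lambda>i\<in>I. p i - q i) \<partial>lborelPi I \<partial>lborelPi I)"
  proof (rule nn_integral_cong)
    fix p assume [measurable]: "p \<in> space (lborelPi I)"
    have "(\<integral>\<^sup>+x. F x (\<lambda>i\<in>I. - x i + 2 * p i) \<partial>lborelPi I) =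
        (\<integral>\<^sup>+q. F (\<lambda>i\<in>I. p i + q i) (\<lambda>i\<in>I. - (\<lambda>i\<in>I. p i + q i) i + 2 * p i) \<partial>lborelPi I)"
      using nn_integral_lborelPi_affine[OF I, of "\<lambda>x. F x (\<lambda>i\<in>I. - x i + 2 * p i)" 1 p] by simp
    also have "(\<lambda>q. \<lambda>i\<in>I. - (\<lambda>i\<in>I. p i + q i) i + 2 * p i) = (\<lambda>q. \<lambda>i\<in>I. p i - q i)"
      by (auto simp: fun_eq_iff restrict_def)
    finally show "(\<integral>\<^sup>+x. F x (\<lambda>i\<in>I. - x i + 2 * p i) \<partial>lborelPi I) =
        (\<integral>\<^sup>+q. F (\<lambda>i\<in>I. p i + q i) (\<lambda>i\<in>I. p i - q i) \<partial>lborelPi I)" .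
  qed
  finally show ?thesis .
qed

text \<open>The copies are compared with nonnegative integrals, but expanding (N x - N y)^2 needs
  subtraction; this passes to Bochner integrals, one variable at a time.\<close>

lemma nn_integral_iterated_eq_ennreal:
  assumes "\<And>x y. x \<in> space M \<Longrightarrow> y \<in> space M \<Longrightarrow> 0 \<le> F x y"
    and F: "\<And>x. x \<in> space M \<Longrightarrow> has_bochner_integral M (F x) (g x)"
    and g: "has_bochner_integral M g c"
  shows "(\<integral>\<^sup>+x. \<integral>\<^sup>+y. ennreal (F x y) \<partial>M \<partial>M) = ennreal c"
proof -
  have "(\<integral>\<^sup>+y. ennreal (F x y) \<partial>M) = ennreal (g x)" if "x \<in> space M" for x
    using F[OF that] assms(1)[OF that] by (simp add: has_bochner_integral_iff nn_integral_eq_integral)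
  moreover have "0 \<le> g x" if "x \<in> space M" for x
    using F[OF that] assms(1)[OF that] Bochner_Integration.integral_nonneg[of M "F x"]
    by (auto simp: has_bochner_integral_iff)
  ultimately show ?thesis
    using g by (simp add: has_bochner_integral_iff nn_integral_eq_integral cong: nn_integral_cong)
qed

text \<open>The weight is not normalised, which accounts for the factors of its total mass. Points
  of the product space are extensional, while sums and negatives written as plain functions are not;
  \<open>cong\<close> says that only the coordinates in \<open>I\<close> matter, so the two can be
  exchanged.\<close>

lemma even_log_concave_gaussian_variance_norm:
  fixes I :: "'i set" and \<psi> :: "('i \<Rightarrow> real) \<Rightarrow> real" and a :: real
  defines "N \<equiv> \<lambda>x. \<Sum>i\<in>I. (x i)\<^sup>2"
  defines "w \<equiv> \<lambda>x. exp (- (\<psi> x + a * N x))"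
  assumes I: "finite I" and a: "a > 0" and \<psi>[measurable]: "\<psi> \<in> borel_measurable (lborelPi I)"
    and cong: "\<And>x y. (\<And>i. i \<in> I \<Longrightarrow> x i = y i) \<Longrightarrow> \<psi> x = \<psi> y"
    and even: "\<And>x. \<psi> (\<lambda>i. - x i) = \<psi> x"
    and conv: "\<And>x y. \<psi> (\<lambda>i. (x i + y i) / 2) \<le> (\<psi> x + \<psi> y) / 2"
    and int0[simp]: "integrable (lborelPi I) w" and int2[simp]: "integrable (lborelPi I) (\<lambda>x. N x * w x)"
    and int4[simp]: "integrable (lborelPi I) (\<lambda>x. (N x)\<^sup>2 * w x)"
  shows "(\<integral>x. (N x)\<^sup>2 * w x \<partial>lborelPi I) * (\<integral>x. w x \<partial>lborelPi I) - (\<integral>x. N x * w x \<partial>lborelPi I)\<^sup>2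
    \<le> (\<integral>x. w x \<partial>lborelPi I) * (\<integral>x. N x * w x \<partial>lborelPi I) / a"
proof -
  interpret finite_product_sigma_finite "\<lambda>_::'i. lborel :: real measure" I by standard (rule I)
  let ?P = "lborelPi I"
  have [measurable]: "N \<in> borel_measurable ?P" "w \<in> borel_measurable ?P" unfolding N_def w_def by measurable
  have Nn: "0 \<le> N x" for x by (simp add: N_def sum_nonneg)
  have Ncong: "N x = N y" if "\<And>i. i \<in> I \<Longrightarrow> x i = y i" for x y
    unfolding N_def using that by (intro sum.cong) auto
  have wcong: "w x = w y" if "\<And>i. i \<in> I \<Longrightarrow> x i = y i" for x y
    unfolding w_def using Ncong[of x y] cong[of x y] that by simp
  define F where "F = (\<lambda>x y. ennreal ((N x - N y)\<^sup>2 * (w x * w y)))"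
  \<comment> \<open>\<open>G\<close> is the fibrewise upper bound for \<open>F\<close>: (4 p . q)^2
    contributes 16 and the Gaussian second moment |p|^2 / (4 a), so the product is 4 |p|^2 / a = |x
    + y|^2 / a. \<open>H\<close> is \<open>G\<close> with y reflected; their sum is free of mixed
    terms and can be integrated.\<close>
  define G where "G = (\<lambda>x y. ennreal (N (\<lambda>i. x i + y i) / a * (w x * w y)))"
  define H where "H = (\<lambda>x y. ennreal (N (\<lambda>i. x i - y i) / a * (w x * w y)))"
  have mF[measurable]: "(\<lambda>(x, y). F x y) \<in> borel_measurable (?P \<Otimes>\<^sub>M ?P)" unfolding F_def by measurable
  have mG[measurable]: "(\<lambda>(x, y). G x y) \<in> borel_measurable (?P \<Otimes>\<^sub>M ?P)" unfolding G_def N_def by measurable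
  have mH[measurable]: "(\<lambda>(x, y). H x y) \<in> borel_measurable (?P \<Otimes>\<^sub>M ?P)" unfolding H_def N_def by measurable
  have fiber: "(\<integral>\<^sup>+q. F (\<lambda>i\<in>I. p i + q i) (\<lambda>i\<in>I. p i - q i) \<partial>?P)
      \<le> (\<integral>\<^sup>+q. G (\<lambda>i\<in>I. p i + q i) (\<lambda>i\<in>I. p i - q i) \<partial>?P)" if [measurable]: "p \<in> space ?P" for p
  proof -
    \<comment> \<open>Changing the sign of q swaps the two \<psi>-terms, so \<open>R\<close> is even
      for every p. Midpoint convexity of \<psi> gives its log-concavity. The Gaussian factor left
      over has parameter 2 a by the parallelogram law.\<close>
    define R where "R = (\<lambda>q. exp (- \<psi> (\<lambda>i\<in>I. p i + q i) - \<psi> (\<lambda>i\<in>I. p i - q i)))"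
    have [measurable]: "R \<in> borel_measurable ?P" unfolding R_def by measurable
    define W where "W = (\<lambda>q. exp (- (2 * a) * (\<Sum>i\<in>I. (q i)\<^sup>2)) * R q)"
    define D where "D = (\<lambda>q. \<Sum>i\<in>I. p i * q i)"
    define e where "e = exp (- (2 * a) * N p)"
    have [measurable]: "W \<in> borel_measurable ?P" "D \<in> borel_measurable ?P"
      unfolding W_def D_def by measurable
    have par: "N (\<lambda>i\<in>I. p i + q i) + N (\<lambda>i\<in>I. p i - q i) = 2 * N p + 2 * N q" for q
      unfolding N_def sum.distrib[symmetric] sum_distrib_left
      by (intro sum.cong) (auto simp: power2_eq_square algebra_simps)
    have dif: "N (\<lambda>i\<in>I. p i + q i) - N (\<lambda>i\<in>I. p i - q i) = 4 * D q" for q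
      unfolding N_def D_def sum_subtractf[symmetric] sum_distrib_left
      by (intro sum.cong) (auto simp: power2_eq_square algebra_simps)
    have four: "N (\<lambda>i. (\<lambda>i\<in>I. p i + q i) i + (\<lambda>i\<in>I. p i - q i) i) = 4 * N p" for q
      unfolding N_def sum_distrib_left by (intro sum.cong) (auto simp: power2_eq_square algebra_simps)
    have ww: "w (\<lambda>i\<in>I. p i + q i) * w (\<lambda>i\<in>I. p i - q i) = e * W q" for q
    proof -
      have "w (\<lambda>i\<in>I. p i + q i) * w (\<lambda>i\<in>I. p i - q i) =
          exp (- \<psi> (\<lambda>i\<in>I. p i + q i) - \<psi> (\<lambda>i\<in>I. p i - q i) - a * (N (\<lambda>i\<in>I. p i + q i) + N (\<lambda>i\<in>I. p i - q i)))"
        unfolding w_def exp_add[symmetric] by (simp add: algebra_simps)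
      also have "\<dots> = e * W q"
        unfolding par R_def W_def e_def exp_add[symmetric] by (simp add: N_def algebra_simps flip: exp_add)
      finally show ?thesis .
    qed
    have Rlc: "R x * R y \<le> (R (\<lambda>i\<in>I. (x i + y i) / 2))\<^sup>2" for x y
    proof -
      have "\<psi> (\<lambda>i\<in>I. p i + (\<lambda>i\<in>I. (x i + y i) / 2) i) = \<psi> (\<lambda>i. ((\<lambda>i\<in>I. p i + x i) i + (\<lambda>i\<in>I. p i + y i) i) / 2)"
        "\<psi> (\<lambda>i\<in>I. p i - (\<lambda>i\<in>I. (x i + y i) / 2) i) = \<psi> (\<lambda>i. ((\<lambda>i\<in>I. p i - x i) i + (\<lambda>i\<in>I. p i - y i) i) / 2)"
        by (rule cong; simp add: field_simps)+
      with conv[of "\<lambda>i\<in>I. p i + x i" "\<lambda>i\<in>I. p i + y i"] conv[of "\<lambda>i\<in>I. p i - x i" "\<lambda>i\<in>I. p i - y i"]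
      show ?thesis unfolding R_def power2_eq_square exp_add[symmetric] by simp
    qed
    have Reven: "R (\<lambda>i\<in>I. - x i) = R x" for x
    proof -
      have "\<psi> (\<lambda>i\<in>I. p i + (\<lambda>i\<in>I. - x i) i) = \<psi> (\<lambda>i\<in>I. p i - x i)"
        "\<psi> (\<lambda>i\<in>I. p i - (\<lambda>i\<in>I. - x i) i) = \<psi> (\<lambda>i\<in>I. p i + x i)"
        by (rule cong; simp)+
      then show ?thesis by (simp only: R_def) simp
    qed
    have W0: "0 \<le> W q" for q by (simp add: W_def R_def)
    have e0: "0 \<le> e" by (simp add: e_def)
    have "F (\<lambda>i\<in>I. p i + q i) (\<lambda>i\<in>I. p i - q i) = ennreal (16 * e) * ennreal ((D q)\<^sup>2 * W q)" for q
      unfolding F_def dif ww using W0[of q] e0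
      by (simp add: power_mult_distrib ac_simps flip: ennreal_mult)
    then have "(\<integral>\<^sup>+q. F (\<lambda>i\<in>I. p i + q i) (\<lambda>i\<in>I. p i - q i) \<partial>?P) = ennreal (16 * e) * (\<integral>\<^sup>+q. ennreal ((D q)\<^sup>2 * W q) \<partial>?P)"
      by (simp add: nn_integral_cmult)
    also have "\<dots> \<le> ennreal (16 * e) * (ennreal (N p / (2 * (2 * a))) * (\<integral>\<^sup>+q. ennreal (W q) \<partial>?P))"
      unfolding W_def D_def N_def
      by (intro mult_left_mono even_log_concave_gaussian_variance[OF I]) (use a Rlc Reven in \<open>auto simp: R_def\<close>)
    also have "\<dots> = ennreal (4 * e * N p / a) * (\<integral>\<^sup>+q. ennreal (W q) \<partial>?P)"
      using a Nn[of p] e0 by (simp add: mult.assoc[symmetric] flip: ennreal_mult)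
    also have "\<dots> = (\<integral>\<^sup>+q. ennreal (4 * e * N p / a) * ennreal (W q) \<partial>?P)"
      by (simp add: nn_integral_cmult)
    also have "\<dots> = (\<integral>\<^sup>+q. G (\<lambda>i\<in>I. p i + q i) (\<lambda>i\<in>I. p i - q i) \<partial>?P)"
      unfolding G_def four ww using a Nn[of p] W0 e0
      by (simp add: ac_simps flip: ennreal_mult)
    finally show ?thesis .
  qed
  have FG: "(\<integral>\<^sup>+x. \<integral>\<^sup>+y. F x y \<partial>?P \<partial>?P) \<le> (\<integral>\<^sup>+x. \<integral>\<^sup>+y. G x y \<partial>?P \<partial>?P)"
    unfolding nn_integral_lborelPi_sum_diff[OF I mF] nn_integral_lborelPi_sum_diff[OF I mG]
    by (intro mult_left_mono nn_integral_mono fiber) auto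
  \<comment> \<open>This is where the evenness of \<psi> enters: the weight of y is invariant under
    reflection.\<close>
  have GH: "(\<integral>\<^sup>+x. \<integral>\<^sup>+y. G x y \<partial>?P \<partial>?P) = (\<integral>\<^sup>+x. \<integral>\<^sup>+y. H x y \<partial>?P \<partial>?P)"
  proof (rule nn_integral_cong)
    fix x assume [measurable]: "x \<in> space ?P"
    have "(\<integral>\<^sup>+y. G x y \<partial>?P) = (\<integral>\<^sup>+y. G x (\<lambda>i\<in>I. - y i) \<partial>?P)"
      using nn_integral_lborelPi_affine[OF I, of "G x" "-1" "\<lambda>_. 0"] by simp
    moreover have "G x (\<lambda>i\<in>I. - y i) = H x y" for y
    proof -
      have "w (\<lambda>i\<in>I. - y i) = w (\<lambda>i. - y i)" by (rule wcong) simp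
      also have "\<dots> = w y" by (simp add: w_def even N_def)
      finally have "w (\<lambda>i\<in>I. - y i) = w y" .
      moreover have "N (\<lambda>i. x i + (\<lambda>i\<in>I. - y i) i) = N (\<lambda>i. x i - y i)" by (rule Ncong) simp
      ultimately show ?thesis by (simp only: G_def H_def)
    qed
    ultimately show "(\<integral>\<^sup>+y. G x y \<partial>?P) = (\<integral>\<^sup>+y. H x y \<partial>?P)" by simp
  qed
  define m0 m2 m4 where "m0 = (\<integral>x. w x \<partial>?P)" and "m2 = (\<integral>x. N x * w x \<partial>?P)" and "m4 = (\<integral>x. (N x)\<^sup>2 * w x \<partial>?P)"
  have has: "has_bochner_integral ?P w m0" "has_bochner_integral ?P (\<lambda>x. N x * w x) m2"
    "has_bochner_integral ?P (\<lambda>x. (N x)\<^sup>2 * w x) m4"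
    by (simp_all add: has_bochner_integral_iff m0_def m2_def m4_def)
  \<comment> \<open>Doubling, rather than halving G + H, avoids division in \<open>ennreal\<close>.
    The double integral of \<open>F\<close> is itself twice the variance expression, so a factor 4
    is cancelled at the end.\<close>
  have "2 * (\<integral>\<^sup>+x. \<integral>\<^sup>+y. F x y \<partial>?P \<partial>?P) \<le> (\<integral>\<^sup>+x. \<integral>\<^sup>+y. G x y \<partial>?P \<partial>?P) + (\<integral>\<^sup>+x. \<integral>\<^sup>+y. H x y \<partial>?P \<partial>?P)"
    using FG by (simp add: GH mult_2 add_mono)
  also have "\<dots> = (\<integral>\<^sup>+x. (\<integral>\<^sup>+y. G x y \<partial>?P) + (\<integral>\<^sup>+y. H x y \<partial>?P) \<partial>?P)"
    using borel_measurable_nn_integral[OF mG] borel_measurable_nn_integral[OF mH]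
    by (rule nn_integral_add[symmetric])
  also have "\<dots> = (\<integral>\<^sup>+x. \<integral>\<^sup>+y. G x y + H x y \<partial>?P \<partial>?P)"
  proof (rule nn_integral_cong)
    fix x assume x: "x \<in> space ?P"
    show "(\<integral>\<^sup>+y. G x y \<partial>?P) + (\<integral>\<^sup>+y. H x y \<partial>?P) = (\<integral>\<^sup>+y. G x y + H x y \<partial>?P)"
      using measurable_Pair2[OF mG x] measurable_Pair2[OF mH x] by (simp add: nn_integral_add)
  qed
  also have "\<dots> = (\<integral>\<^sup>+x. \<integral>\<^sup>+y. ennreal (2 / a * (N x + N y) * (w x * w y)) \<partial>?P \<partial>?P)"
  proof (intro nn_integral_cong)
    fix x y
    have "N (\<lambda>i. x i + y i) + N (\<lambda>i. x i - y i) = 2 * (N x + N y)"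
      unfolding N_def sum.distrib[symmetric] sum_distrib_left
      by (intro sum.cong) (auto simp: power2_eq_square algebra_simps)
    then have "(N (\<lambda>i. x i + y i) / a + N (\<lambda>i. x i - y i) / a) * (w x * w y) = 2 / a * (N x + N y) * (w x * w y)"
      by (simp add: add_divide_distrib[symmetric])
    then show "G x y + H x y = ennreal (2 / a * (N x + N y) * (w x * w y))"
      unfolding G_def H_def using a Nn by (subst ennreal_plus[symmetric]) (auto simp: w_def distrib_right)
  qed
  also have "\<dots> = ennreal (4 / a * (m2 * m0))"
  proof (rule nn_integral_iterated_eq_ennreal)
    show "0 \<le> 2 / a * (N x + N y) * (w x * w y)" for x y
      using a Nn by (simp add: w_def)
    have "has_bochner_integral ?P (\<lambda>y. (2 / a * (N x * w x)) * w y + (2 / a * w x) * (N y * w y))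
        ((2 / a * (N x * w x)) * m0 + (2 / a * w x) * m2)" for x
      by (intro has_bochner_integral_add has_bochner_integral_mult_right has)
    then show "has_bochner_integral ?P (\<lambda>y. 2 / a * (N x + N y) * (w x * w y))
        ((2 / a * m0) * (N x * w x) + (2 / a * m2) * w x)" for x
      by (rule has_bochner_integral_cong[THEN iffD1, rotated 3]) (auto simp: algebra_simps add_divide_distrib)
    have "has_bochner_integral ?P (\<lambda>x. (2 / a * m0) * (N x * w x) + (2 / a * m2) * w x)
        ((2 / a * m0) * m2 + (2 / a * m2) * m0)"
      by (intro has_bochner_integral_add has_bochner_integral_mult_right has)
    then show "has_bochner_integral ?P (\<lambda>x. (2 / a * m0) * (N x * w x) + (2 / a * m2) * w x) (4 / a * (m2 * m0))"
      by (simp add: algebra_simps)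
  qed
  also have "(\<integral>\<^sup>+x. \<integral>\<^sup>+y. F x y \<partial>?P \<partial>?P) = ennreal (2 * (m4 * m0 - m2\<^sup>2))"
    unfolding F_def
  proof (rule nn_integral_iterated_eq_ennreal)
    show "0 \<le> (N x - N y)\<^sup>2 * (w x * w y)" for x y by (simp add: w_def)
    have "has_bochner_integral ?P
        (\<lambda>y. ((N x)\<^sup>2 * w x) * w y + (- 2 * (N x * w x)) * (N y * w y) + w x * ((N y)\<^sup>2 * w y))
        (((N x)\<^sup>2 * w x) * m0 + (- 2 * (N x * w x)) * m2 + w x * m4)" for x
      by (intro has_bochner_integral_add has_bochner_integral_mult_right has)
    then show "has_bochner_integral ?P (\<lambda>y. (N x - N y)\<^sup>2 * (w x * w y))
        (m0 * ((N x)\<^sup>2 * w x) + (- 2 * m2) * (N x * w x) + m4 * w x)" for x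
      by (rule has_bochner_integral_cong[THEN iffD1, rotated 3]) (auto simp: algebra_simps power2_eq_square)
    have "has_bochner_integral ?P (\<lambda>x. m0 * ((N x)\<^sup>2 * w x) + (- 2 * m2) * (N x * w x) + m4 * w x)
        (m0 * m4 + (- 2 * m2) * m2 + m4 * m0)"
      by (intro has_bochner_integral_add has_bochner_integral_mult_right has)
    then show "has_bochner_integral ?P (\<lambda>x. m0 * ((N x)\<^sup>2 * w x) + (- 2 * m2) * (N x * w x) + m4 * w x)
        (2 * (m4 * m0 - m2\<^sup>2))"
      by (simp add: algebra_simps power2_eq_square)
  qed
  finally have "2 * ennreal (2 * (m4 * m0 - m2\<^sup>2)) \<le> ennreal (4 / a * (m2 * m0))" .
  then have "ennreal (2 * (2 * (m4 * m0 - m2\<^sup>2))) \<le> ennreal (4 / a * (m2 * m0))"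
    by (subst ennreal_mult') simp_all
  moreover have "0 \<le> 4 / a * (m2 * m0)"
    using a Nn by (auto simp: m0_def m2_def w_def intro!: mult_nonneg_nonneg integral_nonneg)
  ultimately have "2 * (2 * (m4 * m0 - m2\<^sup>2)) \<le> 4 / a * (m2 * m0)"
    by (simp only: ennreal_le_iff)
  also have "4 / a * (m2 * m0) = 4 * (m0 * m2 / a)" by simp
  finally have *: "2 * (2 * (m4 * m0 - m2\<^sup>2)) \<le> 4 * (m0 * m2 / a)" .
  have "u \<le> v" if "2 * (2 * u) \<le> 4 * v" for u v :: real using that by simp
  from this[OF *] have "m4 * m0 - m2\<^sup>2 \<le> m0 * m2 / a" .
  then show ?thesis
    unfolding m0_def[symmetric] m2_def[symmetric] m4_def[symmetric] .
qed

section \<open>Sublevel sets of 2-homogeneous functions\<close>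

text \<open>Write exp (- Q x) as the integral of exp (- t) over t >= Q x and exchange the integrals.
  The set {Q <= t} is sqrt t times {Q <= 1}, so a k-homogeneous \<open>F\<close> contributes t to
  the power (card I + k) / 2, and the remaining integral in t is a Gamma value.\<close>

lemma nn_integral_exp_neg_two_homogeneous:
  fixes I :: "'i set" and Q F :: "('i \<Rightarrow> real) \<Rightarrow> real"
  assumes I: "finite I" and [measurable]: "Q \<in> borel_measurable (lborelPi I)" "F \<in> borel_measurable (lborelPi I)"
    and Q0: "\<And>x. 0 \<le> Q x" and F0: "\<And>x. 0 \<le> F x"
    and Qh: "\<And>t x. t > 0 \<Longrightarrow> Q (\<lambda>i\<in>I. t * x i) = t\<^sup>2 * Q x"
    and Fh: "\<And>t x. t > 0 \<Longrightarrow> F (\<lambda>i\<in>I. t * x i) = t ^ k * F x"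
  shows "(\<integral>\<^sup>+x. ennreal (F x * exp (- Q x)) \<partial>lborelPi I) =
    ennreal (Gamma (real (card I + k) / 2 + 1)) * (\<integral>\<^sup>+x. ennreal (F x * indicator {x. Q x \<le> 1} x) \<partial>lborelPi I)"
proof -
  interpret finite_product_sigma_finite "\<lambda>_::'i. lborel :: real measure" I by standard (rule I)
  interpret pair_sigma_finite "lborelPi I" "lborel :: real measure" ..
  let ?P = "lborelPi I"
  define s where "s = real (card I + k) / 2 + 1"
  define J where "J = (\<integral>\<^sup>+x. ennreal (F x * indicator {x. Q x \<le> 1} x) \<partial>?P)"
  have tail: "ennreal (exp (- u)) = (\<integral>\<^sup>+t. ennreal (exp (- t) * indicator {u..} t) \<partial>lborel)" for u :: real
  proof -
    have "(\<integral>\<^sup>+t. ennreal (exp (- t)) * indicator {u..} t \<partial>lborel) = ennreal (0 - (- exp (- u)))"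
    proof (rule nn_integral_FTC_atLeast)
      show "((\<lambda>t. - exp (- t)) has_real_derivative exp (- x)) (at x)" for x :: real
        by (auto intro!: derivative_eq_intros)
      have "((\<lambda>t::real. exp (- t)) \<longlongrightarrow> 0) at_top"
        by (rule filterlim_compose[OF exp_at_bot filterlim_uminus_at_bot_at_top])
      then show "((\<lambda>t::real. - exp (- t)) \<longlongrightarrow> 0) at_top"
        using tendsto_minus by fastforce
    qed auto
    moreover have "ennreal (exp (- t) * indicator {u..} t) = ennreal (exp (- t)) * indicator {u..} t" for t
      by (auto simp: indicator_def)
    ultimately show ?thesis by simp
  qed
  have s: "0 < s" unfolding s_def by (intro add_nonneg_pos) auto
  have "(\<integral>\<^sup>+x. ennreal (F x * exp (- Q x)) \<partial>?P) =
      (\<integral>\<^sup>+x. (\<integral>\<^sup>+t. ennreal (F x * (exp (- t) * indicator {Q x..} t)) \<partial>lborel) \<partial>?P)"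
  proof (rule nn_integral_cong)
    fix x
    have "ennreal (F x * exp (- Q x)) = ennreal (F x) * (\<integral>\<^sup>+t. ennreal (exp (- t) * indicator {Q x..} t) \<partial>lborel)"
      by (simp only: tail[of "Q x", symmetric]) (simp add: ennreal_mult F0)
    also have "\<dots> = (\<integral>\<^sup>+t. ennreal (F x) * ennreal (exp (- t) * indicator {Q x..} t) \<partial>lborel)"
      by (simp add: nn_integral_cmult)
    finally show "ennreal (F x * exp (- Q x)) = (\<integral>\<^sup>+t. ennreal (F x * (exp (- t) * indicator {Q x..} t)) \<partial>lborel)"
      by (simp add: ennreal_mult F0)
  qed
  also have "\<dots> = (\<integral>\<^sup>+t. (\<integral>\<^sup>+x. ennreal (F x * (exp (- t) * indicator {Q x..} t)) \<partial>?P) \<partial>lborel)"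
    by (rule Fubini'[symmetric]) (simp add: indicator_def, measurable)
  also have "\<dots> = (\<integral>\<^sup>+t. ennreal (indicator {0..} t * t powr (s - 1) / exp t) * J \<partial>lborel)"
  proof (rule nn_integral_cong_AE)
    \<comment> \<open>At t = 0 the set {Q <= 0} is not a dilate of {Q <= 1}, so this single level is
      discarded as a null set. For t < 0 both sides vanish.\<close>
    have scale: "(\<integral>\<^sup>+x. ennreal (F x * (exp (- t) * indicator {Q x..} t)) \<partial>?P) =
        ennreal (indicator {0..} t * t powr (s - 1) / exp t) * J" if t: "t \<noteq> 0" for t
    proof (cases "t > 0")
      case True
      define r where "r = sqrt t"
      have r: "r > 0" "r\<^sup>2 = t" using True by (auto simp: r_def)
      have "(\<integral>\<^sup>+x. ennreal (F x * (exp (- t) * indicator {Q x..} t)) \<partial>?P) =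
          ennreal (r ^ card I) * (\<integral>\<^sup>+x. ennreal (F (\<lambda>i\<in>I. r * x i) * (exp (- t) * indicator {Q (\<lambda>i\<in>I. r * x i)..} t)) \<partial>?P)"
        using nn_integral_lborelPi_affine[OF I, of "\<lambda>x. ennreal (F x * (exp (- t) * indicator {Q x..} t))" r "\<lambda>_. 0"] r
        by (simp add: indicator_def)
      also have "\<dots> = ennreal (r ^ card I) * (\<integral>\<^sup>+x. ennreal (r ^ k * exp (- t)) * ennreal (F x * indicator {x. Q x \<le> 1} x) \<partial>?P)"
      proof (intro arg_cong2[where f = "(*)"] nn_integral_cong refl)
        fix x
        have "(r\<^sup>2 * Q x \<le> t) = (Q x \<le> 1)" using r True by simp
        then have "F (\<lambda>i\<in>I. r * x i) * (exp (- t) * indicator {Q (\<lambda>i\<in>I. r * x i)..} t)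
            = (r ^ k * exp (- t)) * (F x * indicator {x. Q x \<le> 1} x)"
          by (simp add: Qh[OF r(1)] Fh[OF r(1)] indicator_def)
        then show "ennreal (F (\<lambda>i\<in>I. r * x i) * (exp (- t) * indicator {Q (\<lambda>i\<in>I. r * x i)..} t))
            = ennreal (r ^ k * exp (- t)) * ennreal (F x * indicator {x. Q x \<le> 1} x)"
          using r F0 by (simp only:) (rule ennreal_mult, auto simp: indicator_def)
      qed
      also have "\<dots> = ennreal (r ^ card I) * (ennreal (r ^ k * exp (- t)) * J)"
        by (simp add: J_def nn_integral_cmult)
      also have "\<dots> = ennreal (r ^ (card I + k) * exp (- t)) * J"
        using r by (simp add: power_add mult.assoc ennreal_mult)
      also have "r ^ (card I + k) = t powr (s - 1)"
        using True by (simp add: r_def s_def powr_half_sqrt[symmetric] powr_realpow[symmetric] powr_powr)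
      finally show ?thesis using True by (simp add: exp_minus divide_inverse)
    next
      case False
      then have "t < Q x" for x using t Q0[of x] by linarith
      then have "indicator {Q x..} t = (0::real)" for x by (auto simp: indicator_def not_le)
      then show ?thesis using False t by (simp add: indicator_def)
    qed
    have "AE t in lborel. t \<noteq> (0::real)" by (rule AE_lborel_singleton)
    then show "AE t in lborel. (\<integral>\<^sup>+x. ennreal (F x * (exp (- t) * indicator {Q x..} t)) \<partial>?P) =
        ennreal (indicator {0..} t * t powr (s - 1) / exp t) * J"
      by (rule AE_mp) (auto intro!: AE_I2 scale)
  qed
  also have "\<dots> = ennreal (Gamma s) * J"
    using Gamma_conv_nn_integral_real[OF s] by (simp add: nn_integral_multc)
  finally show ?thesis by (simp add: s_def J_def)
qed

section \<open>A dimension-free lower bound for the second moment\<close>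

lemma ln_two_div_sqrt_pi_pos: "0 < ln (2 / sqrt pi)"
  using pi_less_4 real_sqrt_less_mono[of pi 4] by (intro ln_gt_zero) (simp add: field_simps)

text \<open>Jensen's inequality for \<open>exp\<close> against \<open>\<integral> exp (- 4 \<bar>x\<bar>\<^sup>2) = (sqrt pi / 2) ^ n\<close>: a set of measure 1
  cannot concentrate near the origin.\<close>

lemma second_moment_ge_of_measure_1:
  fixes I :: "'i set" and S :: "('i \<Rightarrow> real) set"
  defines "N \<equiv> \<lambda>x. \<Sum>i\<in>I. (x i)\<^sup>2"
  assumes I: "finite I" and [measurable]: "S \<in> sets (lborelPi I)" and S: "measure (lborelPi I) S = 1"
    and int: "integrable (lborelPi I) (\<lambda>x. indicator S x * N x)"
  shows "(\<integral>x. indicator S x * N x \<partial>lborelPi I) \<ge> real (card I) * ln (2 / sqrt pi) / 4"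
proof -
  let ?P = "lborelPi I"
  have [measurable]: "N \<in> borel_measurable ?P" unfolding N_def by measurable
  define m where "m = (\<integral>x. indicator S x * N x \<partial>?P)"
  \<comment> \<open>The exponent 4 is chosen so that this one-dimensional integral is below 1, since
    pi < 4; its n-th power then decays exponentially and forces a second moment linear in n.\<close>
  have gauss: "(\<integral>\<^sup>+t. ennreal (exp (- (4 * t\<^sup>2))) \<partial>lborel) = ennreal (sqrt pi / 2)"
  proof -
    have "(\<integral>\<^sup>+t. ennreal (exp (- (4 * t\<^sup>2))) \<partial>lborel) =
        (\<integral>\<^sup>+t. ennreal (sqrt pi / 2) * ennreal (normal_density 0 (1 / sqrt 8) t) \<partial>lborel)"
      by (intro nn_integral_cong)
        (simp add: normal_density_def real_sqrt_divide real_sqrt_mult power_divide flip: ennreal_mult)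
    also have "\<dots> = ennreal (sqrt pi / 2) * (\<integral>\<^sup>+t. ennreal (normal_density 0 (1 / sqrt 8) t) \<partial>lborel)"
      by (rule nn_integral_cmult) measurable
    also have "(\<integral>\<^sup>+t. ennreal (normal_density 0 (1 / sqrt 8) t) \<partial>lborel) =
        ennreal (\<integral>t. normal_density 0 (1 / sqrt 8) t \<partial>lborel)"
      by (intro nn_integral_eq_integral) (auto intro: integrable_normal_density)
    also have "(\<integral>t. normal_density 0 (1 / sqrt 8) t \<partial>lborel) = 1"
      by (rule integral_normal_density) simp
    finally show ?thesis by simp
  qed
  have "(\<integral>\<^sup>+x. ennreal (exp (- (4 * N x))) \<partial>?P) = (\<integral>\<^sup>+x. (\<Prod>i\<in>I. ennreal (exp (- (4 * (x i)\<^sup>2)))) \<partial>?P)"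
    by (simp add: N_def prod_ennreal exp_sum I sum_distrib_left sum_negf[symmetric])
  also have "\<dots> = ennreal (sqrt pi / 2) ^ card I"
    by (subst lborelPi.product_nn_integral_prod[OF I]) (auto simp: gauss)
  finally have total: "(\<integral>\<^sup>+x. ennreal (exp (- (4 * N x))) \<partial>?P) = ennreal ((sqrt pi / 2) ^ card I)"
    by (simp add: ennreal_power)
  have fin: "emeasure ?P S < top" using S by (auto simp: measure_def enn2real_eq_0_iff less_top)
  \<comment> \<open>The tangent line of exp at - 4 m, cut off to \<open>S\<close>. Its integral is
    exactly exp (- 4 m), because \<open>S\<close> has measure 1 and \<open>m\<close> is its second
    moment; outside \<open>S\<close> it is 0 and so lies below the Gaussian.\<close>
  have has: "has_bochner_integral ?P (\<lambda>x. exp (- 4 * m) * ((1 + 4 * m) * indicator S x - 4 * (indicator S x * N x)))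
      (exp (- 4 * m) * ((1 + 4 * m) * 1 - 4 * m))"
    using has_bochner_integral_real_indicator[of S ?P] fin S int
    by (intro has_bochner_integral_mult_right has_bochner_integral_diff) (auto simp: m_def has_bochner_integral_iff)
  have exp_int: "integrable ?P (\<lambda>x. exp (- (4 * N x)))"
    by (rule integrableI_nn_integral_finite[OF _ _ total]) auto
  have "exp (- 4 * m) = (\<integral>x. exp (- 4 * m) * ((1 + 4 * m) * indicator S x - 4 * (indicator S x * N x)) \<partial>?P)"
    using has by (simp add: has_bochner_integral_iff)
  also have "\<dots> \<le> (\<integral>x. exp (- (4 * N x)) \<partial>?P)"
  proof (rule integral_mono[OF _ exp_int])
    show "integrable ?P (\<lambda>x. exp (- 4 * m) * ((1 + 4 * m) * indicator S x - 4 * (indicator S x * N x)))"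
      using has by (simp add: has_bochner_integral_iff)
    fix x
    have "exp (- 4 * m) * (1 + (4 * m - 4 * N x)) \<le> exp (- 4 * m) * exp (4 * m - 4 * N x)"
      by (intro mult_left_mono exp_ge_add_one_self) auto
    also have "\<dots> = exp (- (4 * N x))" by (simp flip: exp_add)
    finally show "exp (- 4 * m) * ((1 + 4 * m) * indicator S x - 4 * (indicator S x * N x)) \<le> exp (- (4 * N x))"
      by (simp add: indicator_def algebra_simps)
  qed
  also have "\<dots> = (sqrt pi / 2) ^ card I"
    using total by (subst integral_eq_nn_integral) auto
  finally have "exp (- 4 * m) \<le> (sqrt pi / 2) ^ card I" .
  then have "ln (exp (- 4 * m)) \<le> ln ((sqrt pi / 2) ^ card I)" by (subst ln_le_cancel_iff) auto
  then have "- 4 * m \<le> real (card I) * ln (sqrt pi / 2)" by (simp add: ln_realpow)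
  then show ?thesis by (simp add: m_def ln_div field_simps)
qed

lemma ennreal_integral_nonneg_finite:
  fixes f :: "'a \<Rightarrow> real"
  assumes "f \<in> borel_measurable M" "\<And>x. 0 \<le> f x" "(\<integral>\<^sup>+x. ennreal (f x) \<partial>M) = ennreal c" "0 \<le> c"
  shows "integrable M f" "(\<integral>x. f x \<partial>M) = c"
proof -
  show "integrable M f" using assms by (intro integrableI_nn_integral_finite[of f M c]) auto
  show "(\<integral>x. f x \<partial>M) = c" using assms by (subst integral_eq_nn_integral) auto
qed

text \<open>Homogeneity turns each moment over \<open>B\<close> into one of the density, up to a
  Gamma factor. The factors of different orders do not cancel, but their mismatch has a favourable
  sign.\<close>

lemma two_homogeneous_ball_variance:
  fixes I :: "'i set" and \<psi> :: "('i \<Rightarrow> real) \<Rightarrow> real" and a :: real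
  defines "N \<equiv> \<lambda>x. \<Sum>i\<in>I. (x i)\<^sup>2"
  defines "B \<equiv> {x. \<psi> x + a * N x \<le> 1}"
  assumes I: "finite I" and a: "a > 0" and \<psi>[measurable]: "\<psi> \<in> borel_measurable (lborelPi I)"
    and cong: "\<And>x y. (\<And>i. i \<in> I \<Longrightarrow> x i = y i) \<Longrightarrow> \<psi> x = \<psi> y"
    and even: "\<And>x. \<psi> (\<lambda>i. - x i) = \<psi> x"
    and conv: "\<And>x y. \<psi> (\<lambda>i. (x i + y i) / 2) \<le> (\<psi> x + \<psi> y) / 2"
    and hom: "\<And>t x. t > 0 \<Longrightarrow> \<psi> (\<lambda>i. t * x i) = t\<^sup>2 * \<psi> x"
    and nonneg: "\<And>x. 0 \<le> \<psi> x"
    and vol: "measure (lborelPi I) (B \<inter> space (lborelPi I)) = 1"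
  shows "\<And>j. integrable (lborelPi I) (\<lambda>x. indicator B x * N x ^ j)"
    and "(\<integral>x. indicator B x * (N x)\<^sup>2 \<partial>lborelPi I) - (\<integral>x. indicator B x * N x \<partial>lborelPi I)\<^sup>2
      \<le> 2 / (a * (real (card I) + 2)) * (\<integral>x. indicator B x * N x \<partial>lborelPi I)"
proof -
  let ?P = "lborelPi I"
  have [measurable]: "N \<in> borel_measurable ?P" unfolding N_def by measurable
  have Nn: "0 \<le> N x" for x by (simp add: N_def sum_nonneg)
  have Nh: "N (\<lambda>i\<in>I. t * x i) = t\<^sup>2 * N x" for t x
    by (simp add: N_def sum_distrib_left power_mult_distrib)
  have \<psi>h: "\<psi> (\<lambda>i\<in>I. t * x i) = t\<^sup>2 * \<psi> x" if "t > 0" for t x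
    using hom[OF that, of x] cong[of "\<lambda>i\<in>I. t * x i" "\<lambda>i. t * x i"] by simp
  have [measurable]: "(\<lambda>x. indicator B x :: real) \<in> borel_measurable ?P"
    unfolding B_def indicator_def by measurable
  \<comment> \<open>Since \<psi> is nonnegative, \<open>B\<close> lies in a ball of squared radius 1
    / a, so all its moments are finite.\<close>
  have NB: "indicator B x * N x ^ j \<le> indicator B x * (1 / a) ^ j" for x j
  proof (cases "x \<in> B")
    case True
    then have "a * N x \<le> 1" using nonneg[of x] by (simp add: B_def)
    then have "N x \<le> 1 / a" using a by (simp add: field_simps)
    then show ?thesis using Nn by (auto intro!: mult_left_mono power_mono)
  qed simp
  have Bint: "integrable ?P (\<lambda>x. indicator B x :: real)"
  proof -
    have "B \<inter> space ?P \<in> sets ?P" unfolding B_def by measurable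
    moreover have "emeasure ?P (B \<inter> space ?P) < \<infinity>"
      using vol by (auto simp: measure_def enn2real_eq_0_iff less_top)
    ultimately have "integrable ?P (indicator (B \<inter> space ?P) :: _ \<Rightarrow> real)"
      by (rule integrable_real_indicator)
    then show ?thesis by (rule Bochner_Integration.integrable_cong[THEN iffD1, rotated 2]) (auto simp: indicator_def)
  qed
  show intB: "integrable ?P (\<lambda>x. indicator B x * N x ^ j)" for j
  proof (rule Bochner_Integration.integrable_bound)
    show "integrable ?P (\<lambda>x. indicator B x * (1 / a) ^ j)" using Bint by simp
    show "AE x in ?P. norm (indicator B x * N x ^ j) \<le> norm (indicator B x * (1 / a) ^ j)"
      using NB a Nn by (auto intro!: AE_I2 simp: abs_mult)
  qed measurable
  define E where "E = (\<lambda>j. \<integral>x. indicator B x * N x ^ j \<partial>?P)"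
  have E0: "E 0 = 1"
  proof -
    have "E 0 = (\<integral>x. indicator (B \<inter> space ?P) x \<partial>?P)"
      unfolding E_def by (intro Bochner_Integration.integral_cong) (auto simp: indicator_def)
    also have "\<dots> = measure ?P (B \<inter> space ?P)" by simp
    finally show ?thesis using vol by simp
  qed
  have En: "0 \<le> E j" for j unfolding E_def using Nn by (intro Bochner_Integration.integral_nonneg) auto
  define w where "w = (\<lambda>x. exp (- (\<psi> x + a * N x)))"
  define g where "g = (\<lambda>j. Gamma (real (card I + 2 * j) / 2 + 1))"
  have arg: "0 < real m / 2 + 1" for m by (intro add_nonneg_pos) auto
  have gpos: "0 < g j" for j unfolding g_def by (intro Gamma_real_pos arg)
  have moments: "(\<integral>\<^sup>+x. ennreal (N x ^ j * w x) \<partial>?P) = ennreal (g j * E j)" for j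
  proof -
    have "(\<integral>\<^sup>+x. ennreal (N x ^ j * exp (- (\<psi> x + a * N x))) \<partial>?P) = ennreal (Gamma (real (card I + 2 * j) / 2 + 1)) *
        (\<integral>\<^sup>+x. ennreal (N x ^ j * indicator {x. \<psi> x + a * N x \<le> 1} x) \<partial>?P)"
      by (rule nn_integral_exp_neg_two_homogeneous[OF I])
        (use a nonneg Nn in \<open>auto simp: Nh \<psi>h power_mult_distrib distrib_left simp flip: power_mult\<close>)
    also have "(\<integral>\<^sup>+x. ennreal (N x ^ j * indicator {x. \<psi> x + a * N x \<le> 1} x) \<partial>?P) = ennreal (E j)"
      unfolding E_def B_def[symmetric] using intB[of j] Nn
      by (subst nn_integral_eq_integral[symmetric]) (auto simp: mult.commute)
    finally show ?thesis using gpos[of j] En[of j] by (simp add: w_def g_def ennreal_mult)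
  qed
  have [measurable]: "w \<in> borel_measurable ?P" unfolding w_def by measurable
  have int: "integrable ?P (\<lambda>x. N x ^ j * w x)" and val: "(\<integral>x. N x ^ j * w x \<partial>?P) = g j * E j" for j
  proof -
    have "0 \<le> g j * E j" using gpos[of j] En[of j] by simp
    then show "integrable ?P (\<lambda>x. N x ^ j * w x)" "(\<integral>x. N x ^ j * w x \<partial>?P) = g j * E j"
      using ennreal_integral_nonneg_finite[OF _ _ moments[of j]] Nn by (auto simp: w_def)
  qed
  have "(\<integral>x. (N x)\<^sup>2 * w x \<partial>?P) * (\<integral>x. w x \<partial>?P) - (\<integral>x. N x * w x \<partial>?P)\<^sup>2
    \<le> (\<integral>x. w x \<partial>?P) * (\<integral>x. N x * w x \<partial>?P) / a"
    unfolding w_def N_def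
    by (rule even_log_concave_gaussian_variance_norm[OF I a \<psi> cong even conv])
      (use int[of 0] int[of 1] int[of 2] in \<open>simp_all add: w_def N_def\<close>)
  then have main: "g 2 * E 2 * (g 0 * E 0) - (g 1 * E 1)\<^sup>2 \<le> g 0 * E 0 * (g 1 * E 1) / a"
    using val[of 0] val[of 1] val[of 2] by simp
  \<comment> \<open>The Gamma arguments at orders 0, 2, 4 are h, h + 1, h + 2, so the functional
    equation alone relates the three factors.\<close>
  define h where "h = real (card I) / 2 + 1"
  have h: "0 < h" unfolding h_def by (rule arg)
  have g1: "g 1 = h * g 0"
    using Gamma_plus1[of h] h by (simp add: g_def h_def add_divide_distrib add.commute nonpos_Ints_def)
  have g2: "g 2 = (h + 1) * (h * g 0)"
    using Gamma_plus1[of "h + 1"] h g1 by (simp add: g_def h_def add_divide_distrib algebra_simps nonpos_Ints_def)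
  have "(g 0)\<^sup>2 * h * ((h + 1) * E 2 - h * (E 1)\<^sup>2) \<le> (g 0)\<^sup>2 * h * (E 1 / a)"
    using main unfolding g1 g2 E0 by (simp add: power2_eq_square algebra_simps)
  then have "(h + 1) * E 2 - h * (E 1)\<^sup>2 \<le> E 1 / a"
    using h gpos[of 0] by (subst (asm) mult_le_cancel_left_pos) auto
  \<comment> \<open>Replacing h + 1 by h in front of \<open>E 2\<close> discards a nonnegative term
    and leaves h times the variance.\<close>
  then have "h * (E 2 - (E 1)\<^sup>2) \<le> E 1 / a" using En[of 2] by (simp add: algebra_simps)
  then have "E 2 - (E 1)\<^sup>2 \<le> E 1 / a / h" using h by (subst pos_le_divide_eq) (simp_all only: mult.commute)
  also have "\<dots> = 2 / (a * (real (card I) + 2)) * E 1" by (simp add: h_def field_simps)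
  finally have "E 2 - (E 1)\<^sup>2 \<le> 2 / (a * (real (card I) + 2)) * E 1" .
  then show "(\<integral>x. indicator B x * (N x)\<^sup>2 \<partial>?P) - (\<integral>x. indicator B x * N x \<partial>?P)\<^sup>2
      \<le> 2 / (a * (real (card I) + 2)) * (\<integral>x. indicator B x * N x \<partial>?P)"
    by (simp add: E_def)
qed

section \<open>Support functions and polar bodies\<close>

lemma symmetric_convex_body_uminus:
  assumes "symmetric_convex_body n K" "x \<in> K"
  shows "(\<lambda>i. - x i) \<in> K"
proof -
  have "(\<lambda>i. - x i) \<in> (\<lambda>x i. - x i) ` K" using assms(2) by (rule imageI)
  also have "\<dots> = K" using assms(1) by (simp add: symmetric_convex_body_def)
  finally show ?thesis .
qed

text \<open>If z is an interior point, then z + t e_i for small t > 0 and - z both lie in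
  \<open>K\<close>, and so does their midpoint (t / 2) e_i. Here t is half the radius
  \<open>e\<close>, hence the final e / 4.\<close>

lemma symmetric_convex_body_axis:
  assumes K: "symmetric_convex_body n K" and i: "i < n"
  obtains \<delta> where "\<delta> > 0" "(\<lambda>j. if j = i then \<delta> else 0) \<in> K"
proof -
  have cvx: "convex_Rn K" and "(Euclidean_space n) interior_of K \<noteq> {}"
    using K by (auto simp: symmetric_convex_body_def convex_body_def)
  then obtain U z where U: "openin (Euclidean_space n) U" "U \<subseteq> K" and z: "z \<in> U"
    by (metis all_not_in_conv interior_of_subset openin_interior_of)
  have zn: "z j = 0" if "n \<le> j" for j
    using openin_subset[OF U(1)] z that by (auto simp: topspace_Euclidean_space)
  define c where "c = (\<lambda>(t::real) j. if j < n then z j + (if j = i then t else 0) else 0)"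
  have "continuous_map euclideanreal (Euclidean_space n) c"
    unfolding c_def continuous_map_componentwise_Euclidean_space
  proof (intro allI impI)
    show "continuous_map euclideanreal euclideanreal (\<lambda>t. z j + (if j = i then t else 0))" for j
      by (cases "j = i") (auto intro!: continuous_intros)
  qed
  then have "openin euclideanreal {t \<in> topspace euclideanreal. c t \<in> U}"
    using U(1) by (rule openin_continuous_map_preimage)
  then have "open {t. c t \<in> U}" by simp
  moreover have "c 0 = z" using zn by (auto simp: c_def fun_eq_iff)
  ultimately obtain e where e: "e > 0" "ball 0 e \<subseteq> {t. c t \<in> U}"
    using z by (metis mem_Collect_eq openE)
  have "e / 2 \<in> ball 0 e" using e(1) by simp
  then have "c (e / 2) \<in> K" using e(2) U(2) by blast
  moreover have "(\<lambda>j. - z j) \<in> K" using symmetric_convex_body_uminus[OF K] z U(2) by blast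
  ultimately have "(\<lambda>j. 1 / 2 * c (e / 2) j + 1 / 2 * - z j) \<in> K"
    using cvx[unfolded convex_Rn_def, rule_format, of "c (e / 2)" "\<lambda>j. - z j" "1 / 2" "1 / 2"] by simp
  also have "(\<lambda>j. 1 / 2 * c (e / 2) j + 1 / 2 * - z j) = (\<lambda>j. if j = i then e / 4 else 0)"
    using i zn by (auto simp: c_def fun_eq_iff field_simps)
  finally show ?thesis using that[of "e / 4"] e(1) by simp
qed

text \<open>Testing against \<delta> e_i and its negative bounds the i-th coordinate by 1 /
  \<delta>. Boundedness is what gives the \<open>SUP\<close> in the support function of the polar
  its meaning.\<close>

lemma polar_bounded:
  assumes K: "symmetric_convex_body n K"
  obtains C where "\<And>y i. y \<in> polar n K \<Longrightarrow> i < n \<Longrightarrow> \<bar>y i\<bar> \<le> C"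
proof -
  have "\<exists>C. \<forall>y\<in>polar n K. \<bar>y i\<bar> \<le> C" if i: "i < n" for i
  proof -
    obtain \<delta> where \<delta>: "\<delta> > 0" "(\<lambda>j. if j = i then \<delta> else 0) \<in> K"
      using symmetric_convex_body_axis[OF K i] .
    have m: "(\<lambda>j. - (if j = i then \<delta> else 0)) \<in> K"
      by (rule symmetric_convex_body_uminus[OF K \<delta>(2)])
    have "\<bar>y i\<bar> \<le> 1 / \<delta>" if "y \<in> polar n K" for y
    proof -
      have "dot n y (\<lambda>j. if j = i then \<delta> else 0) \<le> 1" "dot n y (\<lambda>j. - (if j = i then \<delta> else 0)) \<le> 1"
        using that \<delta>(2) m by (auto simp: polar_def)
      then have "y i * \<delta> \<le> 1" "- (y i * \<delta>) \<le> 1"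
        using i by (simp_all add: dot_def if_distrib sum_negf cong: if_cong)
      then show ?thesis using \<delta>(1) by (simp add: field_simps abs_le_iff)
    qed
    then show ?thesis by blast
  qed
  then obtain C where C: "\<And>i y. i < n \<Longrightarrow> y \<in> polar n K \<Longrightarrow> \<bar>y i\<bar> \<le> C i" by metis
  have "\<bar>y i\<bar> \<le> (\<Sum>i<n. \<bar>C i\<bar>)" if "y \<in> polar n K" "i < n" for y i
  proof -
    have "\<bar>y i\<bar> \<le> \<bar>C i\<bar>" using C[OF that(2,1)] by simp
    also have "\<dots> \<le> (\<Sum>i<n. \<bar>C i\<bar>)" using that(2) by (intro member_le_sum) auto
    finally show ?thesis .
  qed
  then show ?thesis using that by blast
qed

section \<open>Support functions of bounded sets\<close>

lemma dot_cong: "(\<And>i. i < n \<Longrightarrow> x i = x' i) \<Longrightarrow> dot n x y = dot n x' y"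
  by (simp add: dot_def)

lemma support_fun_cong: "(\<And>i. i < n \<Longrightarrow> x i = y i) \<Longrightarrow> support_fun n S x = support_fun n S y"
  unfolding support_fun_def using dot_cong[of n x y] by simp

lemma dot_continuous: "continuous_on UNIV (dot n x)"
  unfolding dot_def by (intro continuous_intros continuous_on_product_coordinates)

text \<open>Later instantiated with the polar of \<open>K\<close>. The facts hold for every function
  x, also outside \<open>Rn n\<close>, because \<open>dot n\<close> reads only the first n
  coordinates; they can thus be used on the extensional points of the product space.\<close>

locale bounded_in_Rn =
  fixes n :: nat and S :: "(nat \<Rightarrow> real) set" and C :: real
  assumes bound: "\<And>y i. y \<in> S \<Longrightarrow> i < n \<Longrightarrow> \<bar>y i\<bar> \<le> C" and zero: "(\<lambda>_. 0) \<in> S"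
begin

lemma dot_le: "y \<in> S \<Longrightarrow> dot n x y \<le> C * (\<Sum>i<n. \<bar>x i\<bar>)"
  unfolding dot_def sum_distrib_left
proof (rule sum_mono)
  fix i assume *: "y \<in> S" "i \<in> {..<n}"
  have "x i * y i \<le> \<bar>x i\<bar> * \<bar>y i\<bar>" by (simp flip: abs_mult)
  also have "\<dots> \<le> \<bar>x i\<bar> * C" using bound[of y i] * by (intro mult_left_mono) auto
  finally show "x i * y i \<le> C * \<bar>x i\<bar>" by (simp add: mult.commute)
qed

lemma dot_le_support_fun: "y \<in> S \<Longrightarrow> dot n x y \<le> support_fun n S x"
  unfolding support_fun_def by (rule cSUP_upper[OF _ bdd_aboveI2[OF dot_le]])

lemma support_fun_le: "(\<And>y. y \<in> S \<Longrightarrow> dot n x y \<le> c) \<Longrightarrow> support_fun n S x \<le> c"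
  unfolding support_fun_def using zero by (intro cSUP_least) auto

lemma support_fun_nonneg: "0 \<le> support_fun n S x"
  using dot_le_support_fun[OF zero, of x] by (simp add: dot_def)

lemma support_fun_scale_le: "t > 0 \<Longrightarrow> support_fun n S (\<lambda>i. t * x i) \<le> t * support_fun n S x"
proof (rule support_fun_le)
  fix y assume "t > 0" "y \<in> S"
  moreover have "dot n (\<lambda>i. t * x i) y = t * dot n x y" by (simp add: dot_def sum_distrib_left mult.assoc)
  ultimately show "dot n (\<lambda>i. t * x i) y \<le> t * support_fun n S x" using dot_le_support_fun by simp
qed

lemma support_fun_scale:
  assumes "t > 0"
  shows "support_fun n S (\<lambda>i. t * x i) = t * support_fun n S x"
proof (rule antisym)
  have "support_fun n S x \<le> 1 / t * support_fun n S (\<lambda>i. t * x i)"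
    using support_fun_scale_le[of "1 / t" "\<lambda>i. t * x i"] assms by simp
  then show "t * support_fun n S x \<le> support_fun n S (\<lambda>i. t * x i)" using assms by (simp add: field_simps)
qed (rule support_fun_scale_le[OF assms])

lemma support_fun_add: "support_fun n S (\<lambda>i. x i + y i) \<le> support_fun n S x + support_fun n S y"
proof (rule support_fun_le)
  fix z assume z: "z \<in> S"
  have "dot n (\<lambda>i. x i + y i) z = dot n x z + dot n y z"
    by (simp add: dot_def sum.distrib distrib_right)
  then show "dot n (\<lambda>i. x i + y i) z \<le> support_fun n S x + support_fun n S y"
    using dot_le_support_fun[OF z, of x] dot_le_support_fun[OF z, of y] by simp
qed

lemma support_fun_uminus:
  assumes "\<And>y. y \<in> S \<Longrightarrow> (\<lambda>i. - y i) \<in> S"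
  shows "support_fun n S (\<lambda>i. - x i) = support_fun n S x"
proof -
  have "support_fun n S (\<lambda>i. - x i) \<le> support_fun n S x" for x
  proof (rule support_fun_le)
    fix y assume "y \<in> S"
    then show "dot n (\<lambda>i. - x i) y \<le> support_fun n S x"
      using dot_le_support_fun[of "\<lambda>i. - y i" x] assms by (simp add: dot_def)
  qed
  from this[of x] this[of "\<lambda>i. - x i"] show ?thesis by simp
qed

text \<open>Subadditivity and the coordinate bound give a Lipschitz estimate in the first n
  coordinates, hence continuity in the product topology. It supplies the Borel measurability of
  \<psi>.\<close>

lemma support_fun_continuous: "continuous_on UNIV (support_fun n S)"
proof -
  have lip: "\<bar>support_fun n S y - support_fun n S x\<bar> \<le> C * (\<Sum>i<n. \<bar>y i - x i\<bar>)" for x y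
  proof -
    have "support_fun n S y \<le> support_fun n S x + C * (\<Sum>i<n. \<bar>y i - x i\<bar>)" for x y
    proof -
      have "support_fun n S y \<le> support_fun n S x + support_fun n S (\<lambda>i. y i - x i)"
        using support_fun_add[of x "\<lambda>i. y i - x i"] by simp
      also have "support_fun n S (\<lambda>i. y i - x i) \<le> C * (\<Sum>i<n. \<bar>y i - x i\<bar>)"
        by (rule support_fun_le) (rule dot_le)
      finally show ?thesis by simp
    qed
    from this[of y x] this[of x y] show ?thesis by (simp add: abs_le_iff abs_minus_commute)
  qed
  have "(support_fun n S \<longlongrightarrow> support_fun n S x) (at x)" for x
  proof (rule LIM_zero_cancel, rule Lim_null_comparison)
    show "\<forall>\<^sub>F y in at x. norm (support_fun n S y - support_fun n S x) \<le> C * (\<Sum>i<n. \<bar>y i - x i\<bar>)"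
      using lip by (intro always_eventually) simp
    have "((\<lambda>y. y i) \<longlongrightarrow> x i) (at x)" for i
      using continuous_on_product_coordinates[of i] by (auto simp: continuous_on_def)
    then have "((\<lambda>y. C * (\<Sum>i<n. \<bar>y i - x i\<bar>)) \<longlongrightarrow> C * (\<Sum>i<n. \<bar>x i - x i\<bar>)) (at x)"
      by (intro tendsto_intros)
    then show "((\<lambda>y. C * (\<Sum>i<n. \<bar>y i - x i\<bar>)) \<longlongrightarrow> 0) (at x)" by simp
  qed
  then show ?thesis by (auto simp: continuous_on_def)
qed

end

lemma support_fun_unit_ball: "support_fun n (unit_ball n) x = norm2 n x"
proof -
  have zero: "(\<lambda>_. 0) \<in> unit_ball n" by (simp add: unit_ball_def topspace_Euclidean_space L2_set_def)
  have le: "dot n x y \<le> norm2 n x" if "y \<in> unit_ball n" for y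
  proof -
    have "dot n x y \<le> (\<Sum>i<n. \<bar>x i\<bar> * \<bar>y i\<bar>)"
      unfolding dot_def by (intro sum_mono) (simp flip: abs_mult)
    also have "\<dots> \<le> norm2 n x * norm2 n y" by (rule L2_set_mult_ineq)
    also have "\<dots> \<le> norm2 n x * 1" using that by (intro mult_left_mono) (auto simp: unit_ball_def)
    finally show ?thesis by simp
  qed
  have "norm2 n x \<le> support_fun n (unit_ball n) x"
  proof (cases "norm2 n x = 0")
    case True
    moreover have "dot n x (\<lambda>_. 0) \<le> support_fun n (unit_ball n) x"
      unfolding support_fun_def using le by (intro cSUP_upper zero bdd_aboveI2)
    ultimately show ?thesis by (simp add: dot_def)
  next
    case False
    then have pos: "norm2 n x > 0" using L2_set_nonneg[of x "{..<n}"] by linarith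
    define u where "u = (\<lambda>i. if i < n then x i / norm2 n x else 0)"
    have sq: "(\<Sum>i<n. (x i)\<^sup>2) = (norm2 n x)\<^sup>2" by (simp add: L2_set_def sum_nonneg)
    have "(\<Sum>i<n. (u i)\<^sup>2) = 1"
      using pos by (simp add: u_def power_divide sq flip: sum_divide_distrib)
    then have "u \<in> unit_ball n" by (simp add: unit_ball_def topspace_Euclidean_space L2_set_def u_def)
    moreover have "dot n x u = norm2 n x"
      using pos sq by (simp add: dot_def u_def power2_eq_square flip: sum_divide_distrib)
    ultimately show ?thesis
      unfolding support_fun_def using le by (metis bdd_aboveI2 cSUP_upper)
  qed
  moreover have "support_fun n (unit_ball n) x \<le> norm2 n x"
    unfolding support_fun_def using zero le by (intro cSUP_least) auto
  ultimately show ?thesis by simp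
qed

text \<open>Presents T as the set where the support function of M is at most 1. In the class
  considered, the square of that function is Q.\<close>

lemma polar_eq_support_fun_le:
  assumes M: "convex_body n M"
  shows "polar n M = {x \<in> Rn n. support_fun n M x \<le> 1}"
proof -
  have "compactin (Euclidean_space n) M" and int: "(Euclidean_space n) interior_of M \<noteq> {}"
    using M by (auto simp: convex_body_def)
  then have "compact M"
    by (simp add: Euclidean_space_def compactin_subtopology euclidean_product_topology)
  then have "compact (dot n x ` M)" for x
    by (intro compact_continuous_image continuous_on_subset[OF dot_continuous]) auto
  then have "bdd_above (dot n x ` M)" for x
    by (intro bounded_imp_bdd_above compact_imp_bounded)
  moreover have "M \<noteq> {}" using int interior_of_subset by fastforce
  ultimately show ?thesis
    by (auto simp: polar_def support_fun_def cSUP_le_iff)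
qed

lemma polar_uminus:
  assumes "symmetric_convex_body n K" "y \<in> polar n K"
  shows "(\<lambda>i. - y i) \<in> polar n K"
proof -
  have "dot n (\<lambda>i. - y i) x \<le> 1" if "x \<in> K" for x
  proof -
    have "dot n y (\<lambda>i. - x i) \<le> 1"
      using symmetric_convex_body_uminus[OF assms(1) that] assms(2) by (simp add: polar_def)
    then show ?thesis by (simp add: dot_def)
  qed
  then show ?thesis using assms(2) by (simp add: polar_def topspace_Euclidean_space)
qed

section \<open>Bodies of the class as sublevel sets\<close>

lemma pad_in_Rn: "pad n x \<in> Rn n"
  by (simp add: pad_def topspace_Euclidean_space)

lemma integral_over_eq:
  assumes [measurable]: "T \<in> sets borel" "f \<in> borel_measurable borel"
  shows "integral_over n T f = (\<integral>x. indicator T (pad n x) * f (pad n x) \<partial>lborelPi {..<n})"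
  unfolding integral_over_def set_lebesgue_integral_def lebesgue_Rn_def
  by (subst integral_distr) auto

lemma convex_body_borel: "convex_body n T \<Longrightarrow> T \<in> sets borel"
  by (auto simp: convex_body_def Euclidean_space_def compactin_subtopology euclidean_product_topology
      intro: borel_compact)

text \<open>Isotropy makes all coordinate second moments equal to one number c, which for volume 1
  is L^2, so the second moment of the norm is n c. This identity feeds both claims: it rewrites the
  variance bound, and it turns the lower bound on the second moment into one on L.\<close>

lemma class_C_variance:
  assumes n: "n \<ge> 1" and a: "a > 0" and T: "convex_body n T" "T \<in> class_C n a" "vol n T = 1"
  shows "sigma_sq n T \<le> 2 / (a * (real n + 2) * (isotropic_constant n T)\<^sup>2)"
    and "(isotropic_constant n T)\<^sup>2 \<ge> ln (2 / sqrt pi) / 4"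
proof -
  obtain K M where K: "symmetric_convex_body n K" and M: "is_sum2 n (polar n K) a (unit_ball n) M"
    and TM: "T = polar n M" and iso: "isotropic n T"
    using T(2) by (auto simp: class_C_def)
  obtain C where C: "\<And>y i. y \<in> polar n K \<Longrightarrow> i < n \<Longrightarrow> \<bar>y i\<bar> \<le> C"
    using polar_bounded[OF K] by blast
  interpret bounded_in_Rn n "polar n K" C
    by standard (auto simp: C polar_def topspace_Euclidean_space dot_def)
  let ?P = "lborelPi {..<n}"
  let ?h = "support_fun n (polar n K)"
  define \<psi> where "\<psi> = (\<lambda>x. (?h x)\<^sup>2)"
  define N where "N = (\<lambda>x::nat \<Rightarrow> real. \<Sum>i<n. (x i)\<^sup>2)"
  define B where "B = {x. \<psi> x + a * N x \<le> 1}"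
  \<comment> \<open>Points of the product space are \<open>undefined\<close> beyond n, points of
    \<open>Rn n\<close> are 0 there. \<open>N\<close> and \<psi> do not see the difference, so
    integrals over T become integrals over \<open>B\<close>.\<close>
  have Npad: "N (pad n x) = N x" for x by (simp add: N_def pad_def)
  have \<psi>cong: "\<psi> x = \<psi> y" if "\<And>i. i \<in> {..<n} \<Longrightarrow> x i = y i" for x y
    using support_fun_cong[of n x y "polar n K"] that by (simp add: \<psi>_def)
  have \<psi>pad: "\<psi> (pad n x) = \<psi> x" for x by (rule \<psi>cong) (simp add: pad_def)
  have norm: "(norm2 n x)\<^sup>2 = N x" for x by (simp add: L2_set_def N_def sum_nonneg)
  have norm4: "norm2 n x ^ 4 = (N x)\<^sup>2" for x by (simp flip: norm power_mult)
  have TB: "T = {x \<in> Rn n. x \<in> B}"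
    using M unfolding TM is_sum2_def
    by (auto simp: polar_eq_support_fun_le support_fun_unit_ball norm B_def \<psi>_def)
  have indTB: "indicator T (pad n x) = (indicator B x :: real)" for x
    using pad_in_Rn[of n x] by (simp add: TB indicator_def B_def Npad \<psi>pad)
  have [measurable]: "T \<in> sets borel" by (rule convex_body_borel[OF T(1)])
  have \<psi>m[measurable]: "\<psi> \<in> borel_measurable ?P"
  proof -
    have "continuous_on UNIV \<psi>" unfolding \<psi>_def by (intro continuous_intros support_fun_continuous)
    then have "\<psi> \<in> borel_measurable borel" by (rule borel_measurable_continuous_onI)
    then have "(\<lambda>x. \<psi> (pad n x)) \<in> borel_measurable ?P" by measurable
    then show ?thesis by (simp add: \<psi>pad)
  qed
  have [measurable]: "N \<in> borel_measurable ?P" unfolding N_def by measurable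
  have over: "integral_over n T f = (\<integral>x. indicator B x * f (pad n x) \<partial>?P)"
    if "continuous_on UNIV f" for f
    using integral_over_eq[of T f n] borel_measurable_continuous_onI[OF that] by (simp add: indTB)
  have cont_N: "continuous_on UNIV N"
    unfolding N_def by (intro continuous_intros continuous_on_product_coordinates)
  have S: "B \<inter> space ?P \<in> sets ?P" unfolding B_def by measurable
  have vol: "measure ?P (B \<inter> space ?P) = 1"
  proof -
    have "pad n -` T \<inter> space ?P = B \<inter> space ?P"
      using pad_in_Rn[of n] by (auto simp: TB B_def Npad \<psi>pad)
    then show ?thesis using T(3) by (simp add: vol_def lebesgue_Rn_def measure_distr)
  qed
  define E2 where "E2 = (\<integral>x. indicator B x * N x \<partial>?P)"
  define E4 where "E4 = (\<integral>x. indicator B x * (N x)\<^sup>2 \<partial>?P)"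
  have hom: "\<psi> (\<lambda>i. t * x i) = t\<^sup>2 * \<psi> x" if "t > 0" for t x
    using support_fun_scale[OF that] by (simp add: \<psi>_def power_mult_distrib)
  \<comment> \<open>The support function is convex and nonnegative, so its square is convex as
    well.\<close>
  have conv: "\<psi> (\<lambda>i. (x i + y i) / 2) \<le> (\<psi> x + \<psi> y) / 2" for x y
  proof -
    have "?h (\<lambda>i. (x i + y i) / 2) = 1 / 2 * ?h (\<lambda>i. x i + y i)"
      using support_fun_scale[of "1 / 2" "\<lambda>i. x i + y i"] by simp
    also have "\<dots> \<le> (?h x + ?h y) / 2" using support_fun_add[of x y] by simp
    finally have "\<psi> (\<lambda>i. (x i + y i) / 2) \<le> ((?h x + ?h y) / 2)\<^sup>2"
      unfolding \<psi>_def by (intro power_mono support_fun_nonneg)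
    also have "\<dots> \<le> (\<psi> x + \<psi> y) / 2"
      using zero_le_power2[of "?h x - ?h y"] by (simp add: \<psi>_def power2_eq_square field_simps)
    finally show ?thesis .
  qed
  have even: "\<psi> (\<lambda>i. - x i) = \<psi> x" for x
    by (simp add: \<psi>_def support_fun_uminus polar_uminus[OF K])
  have \<psi>nonneg: "0 \<le> \<psi> x" for x by (simp add: \<psi>_def)
  note ball = two_homogeneous_ball_variance[of "{..<n}" a \<psi>,
      OF finite_lessThan a \<psi>m \<psi>cong even conv hom \<psi>nonneg vol[unfolded B_def N_def]]
  have Bint: "integrable ?P (\<lambda>x. indicator B x * N x ^ j)" for j
    unfolding B_def N_def by (rule ball(1))
  have var: "E4 - E2\<^sup>2 \<le> 2 / (a * (real n + 2)) * E2"
    using ball(2) unfolding E2_def E4_def B_def N_def by simp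
  have E2_ge: "real n * ln (2 / sqrt pi) / 4 \<le> E2"
  proof -
    have eq: "indicator (B \<inter> space ?P) x = (indicator B x :: real)" if "x \<in> space ?P" for x
      using that by (simp add: indicator_def)
    have "integrable ?P (\<lambda>x. indicator (B \<inter> space ?P) x * (\<Sum>i<n. (x i)\<^sup>2))"
      using Bint[of 1] by (simp add: eq N_def cong: Bochner_Integration.integrable_cong)
    from second_moment_ge_of_measure_1[OF _ S vol this]
    show ?thesis by (simp add: eq E2_def N_def cong: Bochner_Integration.integral_cong)
  qed
  obtain c where c: "\<And>y. y \<in> unit_sphere n \<Longrightarrow> integral_over n T (\<lambda>x. (dot n x y)\<^sup>2) = c"
    using iso by (auto simp: isotropic_def)
  have axis: "(\<lambda>j. if j = i then 1 else 0) \<in> unit_sphere n" if "i < n" for i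
  proof -
    have "(if j = i then 1 else 0)\<^sup>2 = (if j = i then 1 else 0 :: real)" for j by simp
    then show ?thesis using that by (simp add: unit_sphere_def topspace_Euclidean_space L2_set_def)
  qed
  have coord: "(\<integral>x. indicator B x * (x i)\<^sup>2 \<partial>?P) = c" if i: "i < n" for i
  proof -
    have d: "dot n x (\<lambda>j. if j = i then 1 else 0) = x i" for x
      using i by (simp add: dot_def if_distrib cong: if_cong)
    have "c = integral_over n T (\<lambda>x. (x i)\<^sup>2)" using c[OF axis[OF i]] by (simp add: d)
    also have "\<dots> = (\<integral>x. indicator B x * (pad n x i)\<^sup>2 \<partial>?P)"
      by (rule over) (intro continuous_intros continuous_on_product_coordinates)
    finally show ?thesis using i by (simp add: pad_def)
  qed
  \<comment> \<open>The squared norm is summed over the coordinate directions, which all contribute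
    c.\<close>
  have "E2 = (\<integral>x. (\<Sum>i<n. indicator B x * (x i)\<^sup>2) \<partial>?P)" by (simp add: E2_def N_def sum_distrib_left)
  also have "\<dots> = (\<Sum>i<n. \<integral>x. indicator B x * (x i)\<^sup>2 \<partial>?P)"
  proof (rule Bochner_Integration.integral_sum)
    fix i assume i: "i \<in> {..<n}"
    have [measurable]: "(\<lambda>x. indicator B x :: real) \<in> borel_measurable ?P"
      unfolding B_def indicator_def by measurable
    have [measurable]: "(\<lambda>x. x i) \<in> borel_measurable ?P" using i by measurable
    have "(x i)\<^sup>2 \<le> N x" for x :: "nat \<Rightarrow> real" unfolding N_def using i by (intro member_le_sum) auto
    then have le: "(x i)\<^sup>2 \<le> \<bar>N x\<bar>" for x :: "nat \<Rightarrow> real" by (meson abs_ge_self order_trans)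
    show "integrable ?P (\<lambda>x. indicator B x * (x i)\<^sup>2)"
    proof (rule Bochner_Integration.integrable_bound)
      show "integrable ?P (\<lambda>x. indicator B x * N x)" using Bint[of 1] by simp
      show "AE x in ?P. norm (indicator B x * (x i)\<^sup>2) \<le> norm (indicator B x * N x)"
        using le by (intro AE_I2) (simp add: abs_mult mult_left_mono)
    qed measurable
  qed
  also have "\<dots> = real n * c" by (simp add: coord)
  finally have E2c: "E2 = real n * c" .
  have c_ge: "ln (2 / sqrt pi) / 4 \<le> c"
  proof -
    have "real n * (ln (2 / sqrt pi) / 4) \<le> real n * c" using E2_ge E2c by simp
    then show ?thesis using n by (subst (asm) mult_le_cancel_left_pos) auto
  qed
  have cpos: "0 < c" using c_ge ln_two_div_sqrt_pi_pos by linarith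
  have L: "isotropic_constant n T = sqrt c"
    unfolding isotropic_constant_def
  proof (rule the_equality)
    show "0 < sqrt c \<and> (\<forall>y\<in>unit_sphere n. (sqrt c)\<^sup>2 =
        1 / vol n T powr (real (n + 2) / real n) * integral_over n T (\<lambda>x. (dot n x y)\<^sup>2))"
      using cpos c T(3) by simp
    fix L assume *: "0 < L \<and> (\<forall>y\<in>unit_sphere n. L\<^sup>2 =
        1 / vol n T powr (real (n + 2) / real n) * integral_over n T (\<lambda>x. (dot n x y)\<^sup>2))"
    \<comment> \<open>The sphere is nonempty because n \<ge> 1, and any of its points determines L;
      with volume 1 the normalising power equals 1.\<close>
    have y: "(\<lambda>j. if j = 0 then 1 else 0) \<in> unit_sphere n" using axis[of 0] n by simp
    from * y have "L\<^sup>2 = c" using c[OF y] T(3) by (auto simp: powr_one_eq_one dest: bspec)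
    then show "L = sqrt c" using * by (metis less_imp_le real_sqrt_unique)
  qed
  have L2: "(isotropic_constant n T)\<^sup>2 = c" using L cpos by simp
  show "(isotropic_constant n T)\<^sup>2 \<ge> ln (2 / sqrt pi) / 4" using L2 c_ge by simp
  have "integral_over n T (\<lambda>x. (norm2 n x)\<^sup>2) = E2"
    unfolding norm using over[OF cont_N] by (simp add: Npad E2_def)
  moreover have "integral_over n T (\<lambda>x. norm2 n x ^ 4) = E4"
    unfolding norm4 using over[of "\<lambda>x. (N x)\<^sup>2"] cont_N by (simp add: Npad E4_def continuous_intros)
  ultimately have "sigma_sq n T = (E4 - E2\<^sup>2) / (1 / real n * E2\<^sup>2)"
    by (simp add: sigma_sq_def T(3))
  also have "\<dots> \<le> (2 / (a * (real n + 2)) * E2) / (1 / real n * E2\<^sup>2)"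
    by (intro divide_right_mono var) auto
  also have "\<dots> = 2 / (a * (real n + 2) * (isotropic_constant n T)\<^sup>2)"
    unfolding L2 E2c using n cpos by (simp add: power2_eq_square)
  finally show "sigma_sq n T \<le> 2 / (a * (real n + 2) * (isotropic_constant n T)\<^sup>2)" .
qed

theorem theorem4p8:
  shows "(\<forall>n a T. n \<ge> 1 \<longrightarrow> a > 0 \<longrightarrow> convex_body n T \<longrightarrow> T \<in> class_C n a \<longrightarrow> vol n T = 1 \<longrightarrow>
            sigma_sq n T \<le> 2 / (a * (real n + 2) * (isotropic_constant n T)\<^sup>2)) \<and>
         (\<forall>c>0. \<exists>C>0. \<forall>n a T. n \<ge> 1 \<longrightarrow> a > 0 \<longrightarrow> convex_body n T \<longrightarrow> T \<in> class_C n a \<longrightarrow>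
            vol n T = 1 \<longrightarrow> a > c / real n \<longrightarrow> sigma_sq n T \<le> C)"
proof (intro conjI allI impI)
  fix n a T
  assume "n \<ge> 1" "a > 0" "convex_body n T" "T \<in> class_C n a" "vol n T = 1"
  then show "sigma_sq n T \<le> 2 / (a * (real n + 2) * (isotropic_constant n T)\<^sup>2)"
    by (rule class_C_variance(1))
next
  fix c :: real assume c: "c > 0"
  define \<kappa> where "\<kappa> = ln (2 / sqrt pi) / 4"
  have \<kappa>: "0 < \<kappa>" using ln_two_div_sqrt_pi_pos by (simp add: \<kappa>_def)
  show "\<exists>C>0. \<forall>n a T. n \<ge> 1 \<longrightarrow> a > 0 \<longrightarrow> convex_body n T \<longrightarrow> T \<in> class_C n a \<longrightarrow>
      vol n T = 1 \<longrightarrow> a > c / real n \<longrightarrow> sigma_sq n T \<le> C"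
  \<comment> \<open>The witness replaces a (n + 2) by its lower bound c, as a n > c, and L^2 by its
    dimension-free lower bound \<kappa>.\<close>
  proof (intro exI[of _ "2 / (c * \<kappa>)"] conjI allI impI)
    fix n a T
    assume *: "n \<ge> 1" "a > 0" "convex_body n T" "T \<in> class_C n a" "vol n T = 1" and ac: "a > c / real n"
    have "c < a * real n" using ac *(1) by (simp add: field_simps)
    also have "\<dots> \<le> a * (real n + 2)" using *(2) by simp
    finally have "c * \<kappa> \<le> a * (real n + 2) * (isotropic_constant n T)\<^sup>2"
      using class_C_variance(2)[OF *] c \<kappa> unfolding \<kappa>_def[symmetric] by (intro mult_mono) auto
    moreover have "0 < c * \<kappa>" using c \<kappa> by simp
    ultimately have "2 / (a * (real n + 2) * (isotropic_constant n T)\<^sup>2) \<le> 2 / (c * \<kappa>)"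
      by (intro divide_left_mono mult_pos_pos[of _ "c * \<kappa>"]) linarith+
    then show "sigma_sq n T \<le> 2 / (c * \<kappa>)"
      using class_C_variance(1)[OF *] by simp
  qed (use c \<kappa> in auto)
qed

end
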